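(* Fix $\alpha,\beta\in(0,1)$, $\gamma\ge 1$ and $q>0$. Let $p_n\ge n$ with $p_n/n\to\gamma$, $r_n=n^{1-\beta}$, $\delta_n=n^{-\alpha}$, and write $p=p_n$, $r=r_n$, $\delta=\delta_n$. Given the data $X_1,\dots,X_n\in\mathbb{R}^p$, consider testing $H_0^{(n)}$ against $H_1^{(n)}$, where under $H_0^{(n)}$: $X_i\stackrel{iid}{\sim}N(0,I_p)$, and under $H_1^{(n)}$: $(X_i\mid Q)\stackrel{iid}{\sim}N\big(0,\ I_p+\tfrac{\delta}{1-\delta}QQ'\big)$ with $Q$ uniformly distributed on the Stiefel manifold $\mathbb{S}(p,r)$. Let $\hat\Sigma=\frac1n\sum_{i=1}^nX_iX_i'$ and $S_n=\mathrm{tr}(\hat\Sigma)$. (i) If $\alpha+\beta>1$, then as $n\to\infty$, for any (sequence of) test(s), the sum of Type I and Type II errors tends to $1$ (in the sense that no sequence of tests has an error sum asymptotically smaller than $1$: the infimum over all tests of the sum of Type I and Type II errors tends to $1$). (ii) If $\alpha+\beta<1$, then as $n\to\infty$, the level of the test that rejects $H_0^{(n)}$ if and only if $$(2np)^{-1/2}(nS_n-np)\ \ge\ \sqrt{2q\log n}$$ tends to $0$, while its power tends to $1$.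
   Context: $\mathbb{S}(p,r)=\{Q\in\mathbb{R}^{p\times r}:Q'Q=I_r\}$ is the Stiefel manifold; "uniform" means the law invariant under left multiplication by orthogonal $p\times p$ matrices. $r_n=n^{1-\beta}$ is understood as rounded to an integer. Note $I_p+\frac{\delta}{1-\delta}QQ'=(I_p-\delta QQ')^{-1}$. Under $H_1^{(n)}$ the law of the data is the mixture over $Q$ (one $Q$ is drawn, common to all $i$). The Type I error (level) of a test is its rejection probability under $H_0^{(n)}$; the power is the rejection probability under $H_1^{(n)}$; the Type II error is one minus the power. *)

theory Defs
  imports
    "HOL-Probability.Probability"
    "Jordan_Normal_Form.Determinant"
    "Jordan_Normal_Form.Gauss_Jordan_Elimination"
begin

text \<open>
  The dimensions vary with the sample size, so matrices are those of Jordan_Normal_Form, while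
  a point of \<open>\<real>\<^sup>p\<close> is an extensional function on \<open>{..<p}\<close>, so that the library's product
  measures apply.
\<close>

abbreviation euclid_space :: "nat \<Rightarrow> (nat \<Rightarrow> real) measure" where
  "euclid_space p \<equiv> (\<Pi>\<^sub>M j\<in>{..<p}. borel)"

text \<open>A data set \<open>X\<close> consists of the \<open>n\<close> vectors \<open>X i\<close> with coordinates \<open>X i j\<close>.\<close>

abbreviation data_space :: "nat \<Rightarrow> nat \<Rightarrow> (nat \<Rightarrow> nat \<Rightarrow> real) measure" where
  "data_space n p \<equiv> (\<Pi>\<^sub>M i\<in>{..<n}. euclid_space p)"

text \<open>
  The centred normal distribution \<open>N(0, S)\<close>, for positive definite \<open>S\<close>, given by its Lebesgue
  density; \<open>mat_inverse\<close> returns \<open>Some\<close> of the inverse if \<open>S\<close> is invertible.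
\<close>

definition mvn :: "nat \<Rightarrow> real mat \<Rightarrow> (nat \<Rightarrow> real) measure" where
  "mvn p S = density (\<Pi>\<^sub>M j\<in>{..<p}. lborel)
     (\<lambda>x. ennreal (exp (- (scalar_prod (Matrix.vec p x) (the (mat_inverse S) *\<^sub>v Matrix.vec p x)) / 2)
                    / sqrt ((2 * pi) ^ p * Determinant.det S)))"

definition stiefel :: "nat \<Rightarrow> nat \<Rightarrow> real mat set" where
  "stiefel p r = {Q \<in> carrier_mat p r. transpose_mat Q * Q = 1\<^sub>m r}"

text \<open>The Borel sets of the Stiefel manifold, generated by the matrix entries.\<close>

definition stiefel_borel :: "nat \<Rightarrow> nat \<Rightarrow> real mat measure" where
  "stiefel_borel p r =
     vimage_algebra (stiefel p r) (\<lambda>Q. \<lambda>ij\<in>{..<p} \<times> {..<r}. Q $$ ij)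
       (\<Pi>\<^sub>M ij\<in>{..<p} \<times> {..<r}. borel)"

text \<open>Note that \<open>stiefel p p\<close> is the orthogonal group.\<close>

definition uniform_stiefel :: "nat \<Rightarrow> nat \<Rightarrow> real mat measure \<Rightarrow> bool" where
  "uniform_stiefel p r U \<longleftrightarrow>
     prob_space U \<and> sets U = sets (stiefel_borel p r) \<and>
     (\<forall>R \<in> stiefel p p. distr U U (\<lambda>Q. R * Q) = U)"

definition spiked_cov :: "nat \<Rightarrow> real \<Rightarrow> real mat \<Rightarrow> real mat" where
  "spiked_cov p \<delta> Q = 1\<^sub>m p + (\<delta> / (1 - \<delta>)) \<cdot>\<^sub>m (Q * transpose_mat Q)"

definition null_law :: "nat \<Rightarrow> nat \<Rightarrow> (nat \<Rightarrow> nat \<Rightarrow> real) measure" where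
  "null_law n p = (\<Pi>\<^sub>M i\<in>{..<n}. mvn p (1\<^sub>m p))"

definition alt_law ::
    "nat \<Rightarrow> nat \<Rightarrow> real \<Rightarrow> real mat measure \<Rightarrow> (nat \<Rightarrow> nat \<Rightarrow> real) measure" where
  "alt_law n p \<delta> U = U \<bind> (\<lambda>Q. \<Pi>\<^sub>M i\<in>{..<n}. mvn p (spiked_cov p \<delta> Q))"

text \<open>
  Tests may be randomised: \<open>\<phi> X\<close> is the probability of rejecting the null hypothesis given the
  data \<open>X\<close>. A non-randomised test is the indicator of its rejection region.
\<close>

definition tests :: "nat \<Rightarrow> nat \<Rightarrow> ((nat \<Rightarrow> nat \<Rightarrow> real) \<Rightarrow> real) set" where
  "tests n p = {\<phi> \<in> borel_measurable (data_space n p).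
                  \<forall>X \<in> space (data_space n p). 0 \<le> \<phi> X \<and> \<phi> X \<le> 1}"

definition rejection_prob ::
    "(nat \<Rightarrow> nat \<Rightarrow> real) measure \<Rightarrow> ((nat \<Rightarrow> nat \<Rightarrow> real) \<Rightarrow> real) \<Rightarrow> real" where
  "rejection_prob P \<phi> = (\<integral>X. \<phi> X \<partial>P)"

definition test_level ::
    "nat \<Rightarrow> nat \<Rightarrow> ((nat \<Rightarrow> nat \<Rightarrow> real) \<Rightarrow> real) \<Rightarrow> real" where
  "test_level n p \<phi> = rejection_prob (null_law n p) \<phi>"

definition test_power ::
    "nat \<Rightarrow> nat \<Rightarrow> real \<Rightarrow> real mat measure \<Rightarrow> ((nat \<Rightarrow> nat \<Rightarrow> real) \<Rightarrow> real) \<Rightarrow> real" where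
  "test_power n p \<delta> U \<phi> = rejection_prob (alt_law n p \<delta> U) \<phi>"

definition error_sum ::
    "nat \<Rightarrow> nat \<Rightarrow> real \<Rightarrow> real mat measure \<Rightarrow> ((nat \<Rightarrow> nat \<Rightarrow> real) \<Rightarrow> real) \<Rightarrow> real" where
  "error_sum n p \<delta> U \<phi> = test_level n p \<phi> + (1 - test_power n p \<delta> U \<phi>)"

definition sample_cov :: "nat \<Rightarrow> nat \<Rightarrow> (nat \<Rightarrow> nat \<Rightarrow> real) \<Rightarrow> real mat" where
  "sample_cov n p X = Matrix.mat p p (\<lambda>(j, k). 1 / real n * (\<Sum>i<n. X i j * X i k))"

definition mat_trace :: "real mat \<Rightarrow> real" where
  "mat_trace A = (\<Sum>j<dim_row A. A $$ (j, j))"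

definition trace_test :: "real \<Rightarrow> nat \<Rightarrow> nat \<Rightarrow> (nat \<Rightarrow> nat \<Rightarrow> real) \<Rightarrow> real" where
  "trace_test q n p = indicat_real
     {X. (2 * real n * real p) powr (- 1 / 2)
           * (real n * mat_trace (sample_cov n p X) - real n * real p)
         \<ge> sqrt (2 * q * ln (real n))}"

end

theory Submission
  imports Defs "HOL-Real_Asymp.Real_Asymp"
begin

text \<open>
  Given \<open>Q\<close>, the alternative has density \<open>(1 - \<delta>)\<^bsup>rn/2\<^esup> exp (\<delta>/2 \<Sum>\<^sub>i |Q'X\<^sub>i|\<^sup>2)\<close> with respect to the null law.
  Writing \<open>exp (\<delta>/2 |y|\<^sup>2)\<close> as a Gaussian average of exponentials of linear forms makes the integrals
  that are needed explicit without any diagonalisation.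

  For part (i), let \<open>L\<close> be the average of this density over \<open>Q\<close>. An error sum below \<open>1 - \<epsilon>\<close> is
  impossible if the second moment of \<open>L\<close> is at most \<open>1 + \<epsilon>\<^sup>2\<close>. For two independent copies \<open>Q\<close>, \<open>P\<close> and a
  Gaussian \<open>r \<times> n\<close> matrix \<open>Z\<close>, that second moment is a weighted average of \<open>exp (\<kappa>/2 |P'QZ|\<^sup>2)\<close> with
  \<open>\<kappa> = \<delta>\<^sup>2/(1 - \<delta>)\<close>. For fixed \<open>y\<close> the law of \<open>|P'y|\<close> depends on \<open>|y|\<close> only, so \<open>y\<close> may be compared with a
  Gaussian vector, which gives the bound \<open>(1 - \<kappa>|Z|\<^sup>2/p)\<^bsup>-r/2\<^esup>\<close> for the average over \<open>P\<close>. As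
  \<open>|Z|\<^sup>2\<close> is of order \<open>nr\<close> and \<open>n \<le> p\<close>, the second moment is at most \<open>1 + o(1)\<close> as soon as
  \<open>\<delta>r \<rightarrow> 0\<close>, that is, \<open>\<alpha> + \<beta> > 1\<close>.

  For part (ii), Chernoff's bound with exponent \<open>(2np)\<^bsup>-1/2\<^esup>\<close> is applied to \<open>nS\<^sub>n\<close> under both hypotheses.
\<close>

section \<open>Gaussian integrals\<close>

text \<open>Both measures agree on boxes, where the integral of a product factorises, and boxes
  determine a product measure. It serves for the coordinates of one vector as well as for the
  observations of a sample.\<close>

lemma PiM_density:
  assumes "finite I" "product_sigma_finite M" "product_sigma_finite (\<lambda>i. density (M i) (f i))"
    and f [measurable]: "\<And>i. i \<in> I \<Longrightarrow> f i \<in> borel_measurable (M i)"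
  shows "PiM I (\<lambda>i. density (M i) (f i)) = density (PiM I M) (\<lambda>x. \<Prod>i\<in>I. f i (x i))"
proof -
  interpret M: product_sigma_finite M by fact
  interpret D: product_sigma_finite "\<lambda>i. density (M i) (f i)" by fact
  have "density (PiM I M) (\<lambda>x. \<Prod>i\<in>I. f i (x i)) = PiM I (\<lambda>i. density (M i) (f i))"
  proof (rule D.PiM_eqI)
    show "sets (density (PiM I M) (\<lambda>x. \<Prod>i\<in>I. f i (x i))) = sets (PiM I (\<lambda>i. density (M i) (f i)))"
      by (auto intro!: sets_PiM_cong)
    fix A assume A: "\<And>i. i \<in> I \<Longrightarrow> A i \<in> sets (density (M i) (f i))"
    then have A': "\<And>i. i \<in> I \<Longrightarrow> A i \<in> sets (M i)" by simp
    have AP: "Pi\<^sub>E I A \<in> sets (PiM I M)"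
      using A' \<open>finite I\<close> by (intro sets_PiM_I_finite) auto
    have "emeasure (density (PiM I M) (\<lambda>x. \<Prod>i\<in>I. f i (x i))) (Pi\<^sub>E I A)
        = (\<integral>\<^sup>+x. (\<Prod>i\<in>I. f i (x i)) * indicator (Pi\<^sub>E I A) x \<partial>PiM I M)"
      using AP \<open>finite I\<close> by (subst emeasure_density) auto
    also have "\<dots> = (\<integral>\<^sup>+x. (\<Prod>i\<in>I. f i (x i) * indicator (A i) (x i)) \<partial>PiM I M)"
    proof (intro nn_integral_cong)
      fix x assume "x \<in> space (PiM I M)"
      then have "indicator (Pi\<^sub>E I A) x = (\<Prod>i\<in>I. indicator (A i) (x i) :: ennreal)"
        using \<open>finite I\<close> by (auto simp: indicator_def space_PiM PiE_iff prod_zero_iff)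
      then show "(\<Prod>i\<in>I. f i (x i)) * indicator (Pi\<^sub>E I A) x = (\<Prod>i\<in>I. f i (x i) * indicator (A i) (x i))"
        by (simp add: prod.distrib)
    qed
    also have "\<dots> = (\<Prod>i\<in>I. \<integral>\<^sup>+x. f i x * indicator (A i) x \<partial>M i)"
      using A' \<open>finite I\<close> by (subst M.product_nn_integral_prod) auto
    also have "\<dots> = (\<Prod>i\<in>I. emeasure (density (M i) (f i)) (A i))"
      using A' by (intro prod.cong refl) (simp add: emeasure_density)
    finally show "emeasure (density (PiM I M) (\<lambda>x. \<Prod>i\<in>I. f i (x i))) (Pi\<^sub>E I A)
        = (\<Prod>i\<in>I. emeasure (density (M i) (f i)) (A i))" .
  qed fact
  then show ?thesis by simp
qed

section \<open>The standard normal law on R^p as a product measure\<close>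

abbreviation std_normal1 :: "real measure" where
  "std_normal1 \<equiv> density lborel (\<lambda>x. ennreal (std_normal_density x))"

text \<open>Kept apart from \<open>mvn p (1\<^sub>m p)\<close>, which is shown equal in
  \<open>mvn_one\<close>: the product form lets integrals split over coordinates.\<close>

definition std_normal :: "nat \<Rightarrow> (nat \<Rightarrow> real) measure" where
  "std_normal p = (\<Pi>\<^sub>M j\<in>{..<p}. std_normal1)"

lemma prob_space_std_normal1: "prob_space std_normal1"
  by (rule prob_space_normal_density) simp

interpretation SN: product_sigma_finite "\<lambda>_::nat. std_normal1"
  by (simp add: product_sigma_finite_def prob_space_std_normal1 prob_space_imp_sigma_finite)

lemma prob_space_std_normal: "prob_space (std_normal p)"
  unfolding std_normal_def by (rule prob_space_PiM) (rule prob_space_std_normal1)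

lemma sets_std_normal [measurable_cong, simp]: "sets (std_normal p) = sets (euclid_space p)"
  unfolding std_normal_def by (rule sets_PiM_cong) auto

lemma space_std_normal [simp]: "space (std_normal p) = space (euclid_space p)"
  by (rule sets_eq_imp_space_eq) simp

lemma sigma_finite_std_normal: "sigma_finite_measure (std_normal p)"
  using prob_space_std_normal by (rule prob_space_imp_sigma_finite)

section \<open>Squared norms and products with a Stiefel matrix, in coordinates\<close>

definition sqn :: "nat \<Rightarrow> (nat \<Rightarrow> real) \<Rightarrow> real" where
  "sqn p x = (\<Sum>j<p. (x j)\<^sup>2)"

text \<open>\<open>mul r Q z\<close> is Qz and \<open>tmul p Q x\<close> is Q'x, for functions in
  place of vectors; the natural number is the length of the vector summed over.\<close>

definition mul :: "nat \<Rightarrow> real mat \<Rightarrow> (nat \<Rightarrow> real) \<Rightarrow> nat \<Rightarrow> real" where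
  "mul r Q z j = (\<Sum>k<r. Q $$ (j, k) * z k)"

definition tmul :: "nat \<Rightarrow> real mat \<Rightarrow> (nat \<Rightarrow> real) \<Rightarrow> nat \<Rightarrow> real" where
  "tmul p Q x k = (\<Sum>j<p. Q $$ (j, k) * x j)"

lemma sqn_nonneg [simp]: "0 \<le> sqn p x"
  by (simp add: sqn_def sum_nonneg)

lemma sqn_scale: "sqn p (\<lambda>j. s * x j) = s\<^sup>2 * sqn p x"
  by (simp add: sqn_def power_mult_distrib sum_distrib_left)

lemma sqn_eq_0: "sqn p x = 0 \<longleftrightarrow> (\<forall>j<p. x j = 0)"
  by (simp add: sqn_def sum_nonneg_eq_0_iff) blast

lemma tmul_scale: "tmul p Q (\<lambda>j. s * x j) k = s * tmul p Q x k"
  by (simp add: tmul_def sum_distrib_left algebra_simps)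

lemma sqn_zero [simp]: "sqn p (\<lambda>_. 0) = 0"
  by (simp add: sqn_def)

lemma tmul_zero [simp]: "tmul p Q (\<lambda>_. 0) = (\<lambda>_. 0)"
  by (simp add: tmul_def fun_eq_iff)

lemma measurable_sqn [measurable]: "sqn p \<in> borel_measurable (euclid_space p)"
  unfolding sqn_def by measurable

lemma measurable_tmul [measurable]: "(\<lambda>x. tmul p Q x k) \<in> borel_measurable (euclid_space p)"
  unfolding tmul_def by measurable

lemma measurable_mul [measurable]: "(\<lambda>x. mul r Q x k) \<in> borel_measurable (euclid_space r)"
  unfolding mul_def by measurable

lemma stiefel_orthonormal:
  assumes "Q \<in> stiefel p r" "k < r" "l < r"
  shows "(\<Sum>j<p. Q $$ (j, k) * Q $$ (j, l)) = (if k = l then 1 else 0)"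
proof -
  have Q: "Q \<in> carrier_mat p r" "transpose_mat Q * Q = 1\<^sub>m r"
    using assms by (auto simp: stiefel_def)
  have "(transpose_mat Q * Q) $$ (k, l) = (\<Sum>j<p. Q $$ (j, k) * Q $$ (j, l))"
    using Q(1) assms by (simp add: scalar_prod_def lessThan_atLeast0)
  then show ?thesis using Q(2) assms by simp
qed

text \<open>Q and Q' are adjoint; the two finite sums are interchanged.\<close>

lemma sum_mul_eq_sum_tmul:
  "(\<Sum>j<p. a j * mul r Q w j) = (\<Sum>k<r. tmul p Q a k * w k)"
  unfolding mul_def tmul_def sum_distrib_left sum_distrib_right
  by (subst sum.swap) (simp add: algebra_simps)

lemma sum_scaled_mul_eq_sum_scaled_tmul:
  "(\<Sum>j<p. s * mul r Q z j * x j) = (\<Sum>k<r. s * tmul p Q x k * z k)"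
proof -
  have "(\<Sum>j<p. s * mul r Q z j * x j) = s * (\<Sum>j<p. x j * mul r Q z j)"
    by (simp add: sum_distrib_left mult_ac)
  then show ?thesis
    unfolding sum_mul_eq_sum_tmul by (simp add: sum_distrib_left mult_ac)
qed

text \<open>Q is an isometry: Q'Qw = w since the columns are orthonormal, and adjointness turns
  |Qw|^2 into the inner product of Q'Qw with w.\<close>

lemma sqn_mul:
  assumes "Q \<in> stiefel p r"
  shows "sqn p (mul r Q w) = sqn r w"
proof -
  have t: "tmul p Q (mul r Q w) k = w k" if "k < r" for k
  proof -
    have "tmul p Q (mul r Q w) k = (\<Sum>l<r. (\<Sum>j<p. Q $$ (j, k) * Q $$ (j, l)) * w l)"
      unfolding mul_def tmul_def sum_distrib_left sum_distrib_right
      by (subst sum.swap) (simp add: algebra_simps)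
    also have "\<dots> = (\<Sum>l<r. (if k = l then w l else 0))"
      using stiefel_orthonormal[OF assms that] by (intro sum.cong) auto
    also have "\<dots> = w k" using that by simp
    finally show ?thesis .
  qed
  have "sqn p (mul r Q w) = (\<Sum>j<p. mul r Q w j * mul r Q w j)"
    by (simp add: sqn_def power2_eq_square)
  also have "\<dots> = (\<Sum>k<r. w k * w k)"
    unfolding sum_mul_eq_sum_tmul by (intro sum.cong) (auto simp: t)
  finally show ?thesis by (simp add: sqn_def power2_eq_square)
qed

lemma sqn_add_mul:
  assumes "Q \<in> stiefel p r"
  shows "sqn p (\<lambda>j. a j + s * mul r Q w j)
    = sqn p a + s\<^sup>2 * sqn r w + 2 * s * (\<Sum>k<r. tmul p Q a k * w k)"
proof -
  have "sqn p (\<lambda>j. a j + s * mul r Q w j)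
      = sqn p a + s\<^sup>2 * sqn p (mul r Q w) + 2 * s * (\<Sum>j<p. a j * mul r Q w j)"
    unfolding sqn_def sum_distrib_left sum.distrib[symmetric]
    by (intro sum.cong refl) (simp add: power2_eq_square algebra_simps)
  then show ?thesis by (simp add: sqn_mul[OF assms] sum_mul_eq_sum_tmul)
qed

text \<open>Bessel's inequality: the residual y - QQ'y has squared norm |y|^2 - |Q'y|^2, which
  cannot be negative.\<close>

lemma sqn_tmul_le:
  assumes "Q \<in> stiefel p r"
  shows "sqn r (tmul p Q y) \<le> sqn p y"
proof -
  have "0 \<le> sqn p (\<lambda>j. y j + (-1) * mul r Q (tmul p Q y) j)" by (rule sqn_nonneg)
  also have "\<dots> = sqn p y - sqn r (tmul p Q y)"
    unfolding sqn_add_mul[OF assms] by (simp add: sqn_def power2_eq_square)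
  finally show ?thesis by simp
qed

section \<open>Exponential moments of Gaussian vectors\<close>

lemma ennreal_exp_add: "ennreal (exp (x + y)) = ennreal (exp x) * ennreal (exp y)"
  by (simp add: exp_add ennreal_mult')

text \<open>Completing the square turns the integrand into K times the density of a normal law with
  mean a/(1-c) and variance 1/(1-c). Negative c is allowed; the lower tail of the trace statistic
  uses it.\<close>

lemma nn_integral_std_normal1_exp_quad:
  fixes c a :: real
  assumes "c < 1"
  shows "(\<integral>\<^sup>+x. ennreal (exp (c / 2 * x\<^sup>2 + a * x)) \<partial>std_normal1)
    = ennreal (1 / sqrt (1 - c) * exp (a\<^sup>2 / (2 * (1 - c))))"
proof -
  define s m K where "s = 1 / sqrt (1 - c)" and "m = a / (1 - c)"
    and "K = 1 / sqrt (1 - c) * exp (a\<^sup>2 / (2 * (1 - c)))"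
  have c: "1 - c > 0" using assms by simp
  have s: "s > 0" "s\<^sup>2 = 1 / (1 - c)" using c by (auto simp: s_def power_divide)
  have K: "K \<ge> 0" using c by (simp add: K_def)
  have eq: "std_normal_density x * exp (c / 2 * x\<^sup>2 + a * x) = K * normal_density m s x" for x
  proof -
    have sq: "sqrt (2 * pi * s\<^sup>2) = sqrt (2 * pi) / sqrt (1 - c)"
      by (simp add: s(2) real_sqrt_divide)
    have e: "- x\<^sup>2 / 2 + (c / 2 * x\<^sup>2 + a * x) = a\<^sup>2 / (2 * (1 - c)) + - (x - m)\<^sup>2 / (2 * s\<^sup>2)"
    proof -
      have "(x - m)\<^sup>2 * (1 - c) = (1 - c) * x\<^sup>2 - 2 * a * x + a\<^sup>2 / (1 - c)"
      proof -
        have "(x - a / u)\<^sup>2 * u = u * x\<^sup>2 - 2 * a * x + a\<^sup>2 / u" if "u > 0" for u :: real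
          using that by (simp add: field_simps power2_eq_square)
        then show ?thesis using c unfolding m_def by blast
      qed
      have "- y / 2 + ((1 - u) / 2 * y + a * x) = A / (2 * u) - (u * y - 2 * a * x + A / u) / 2"
        if "u > 0" for u y A :: real
        using that by (simp add: field_simps)
      from this[OF c, of "x\<^sup>2" "a\<^sup>2"]
      have "- x\<^sup>2 / 2 + (c / 2 * x\<^sup>2 + a * x)
          = a\<^sup>2 / (2 * (1 - c)) - ((1 - c) * x\<^sup>2 - 2 * a * x + a\<^sup>2 / (1 - c)) / 2"
        by simp
      also have "(1 - c) * x\<^sup>2 - 2 * a * x + a\<^sup>2 / (1 - c) = (x - m)\<^sup>2 * (1 - c)"
        using \<open>(x - m)\<^sup>2 * (1 - c) = _\<close> by simp
      also have "a\<^sup>2 / (2 * (1 - c)) - (x - m)\<^sup>2 * (1 - c) / 2 = a\<^sup>2 / (2 * (1 - c)) + - (x - m)\<^sup>2 / (2 * s\<^sup>2)"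
        by (simp add: s(2))
      finally show ?thesis .
    qed
    have X: "exp (- x\<^sup>2 / 2) * exp (c / 2 * x\<^sup>2 + a * x)
        = exp (a\<^sup>2 / (2 * (1 - c))) * exp (- (x - m)\<^sup>2 / (2 * s\<^sup>2))"
      by (simp only: mult_exp_exp e)
    have "1 / q * (A * B) = 1 / w * A * (1 / (q / w) * B)" if "w > 0" for q w A B :: real
      using that by (simp add: field_simps)
    from this[of "sqrt (1 - c)"] show ?thesis
      unfolding std_normal_density_def normal_density_def K_def sq
      using c X by simp
  qed
  have "(\<integral>\<^sup>+x. ennreal (exp (c / 2 * x\<^sup>2 + a * x)) \<partial>std_normal1)
      = (\<integral>\<^sup>+x. ennreal (K * normal_density m s x) \<partial>lborel)"
    by (subst nn_integral_density) (auto simp: ennreal_mult'[symmetric] eq[symmetric])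
  also have "\<dots> = ennreal K * (\<integral>\<^sup>+x. ennreal (normal_density m s x) \<partial>lborel)"
    using K by (simp add: ennreal_mult' nn_integral_cmult)
  also have "(\<integral>\<^sup>+x. ennreal (normal_density m s x) \<partial>lborel) = ennreal 1"
    using s(1) by (subst nn_integral_eq_integral) auto
  finally show ?thesis by (simp add: K_def)
qed

lemma nn_integral_std_normal_exp_quad:
  fixes c :: real
  assumes "c < 1"
  shows "(\<integral>\<^sup>+x. ennreal (exp (c / 2 * sqn p x + (\<Sum>j<p. a j * x j))) \<partial>std_normal p)
    = ennreal ((1 / sqrt (1 - c)) ^ p * exp (sqn p a / (2 * (1 - c))))"
proof -
  have "(\<integral>\<^sup>+x. ennreal (exp (c / 2 * sqn p x + (\<Sum>j<p. a j * x j))) \<partial>std_normal p)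
      = (\<integral>\<^sup>+x. (\<Prod>j<p. ennreal (exp (c / 2 * (x j)\<^sup>2 + a j * x j))) \<partial>std_normal p)"
    by (intro nn_integral_cong)
      (simp add: prod_ennreal sqn_def sum_distrib_left flip: exp_sum sum.distrib)
  also have "\<dots> = (\<Prod>j<p. \<integral>\<^sup>+x. ennreal (exp (c / 2 * x\<^sup>2 + a j * x)) \<partial>std_normal1)"
    unfolding std_normal_def by (subst SN.product_nn_integral_prod) auto
  also have "\<dots> = (\<Prod>j<p. ennreal (1 / sqrt (1 - c) * exp ((a j)\<^sup>2 / (2 * (1 - c)))))"
    by (intro prod.cong refl nn_integral_std_normal1_exp_quad assms)
  also have "\<dots> = ennreal (\<Prod>j<p. 1 / sqrt (1 - c) * exp ((a j)\<^sup>2 / (2 * (1 - c))))"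
    using assms by (intro prod_ennreal) auto
  also have "(\<Prod>j<p. 1 / sqrt (1 - c) * exp ((a j)\<^sup>2 / (2 * (1 - c))))
      = (1 / sqrt (1 - c)) ^ p * exp (sqn p a / (2 * (1 - c)))"
    by (simp add: prod.distrib sqn_def sum_divide_distrib exp_sum prod_dividef power_divide)
  finally show ?thesis .
qed

text \<open>
  The factor \<open>exp (d / 2 * |Q'x|\<^sup>2)\<close> is linearised as a Gaussian average of exponentials of linear
  forms (Hubbard--Stratonovich), after which the integral over \<open>x\<close> factorises over coordinates.
\<close>

lemma nn_integral_std_normal_exp_proj:
  fixes c d :: real
  assumes Q: "Q \<in> stiefel p r" and c: "c < 1" and d: "0 \<le> d" "d / (1 - c) < 1"
  shows "(\<integral>\<^sup>+x. ennreal (exp (c / 2 * sqn p x + (\<Sum>j<p. a j * x j)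
              + d / 2 * sqn r (tmul p Q x))) \<partial>std_normal p)
    = ennreal ((1 / sqrt (1 - c)) ^ p * (1 / sqrt (1 - d / (1 - c))) ^ r
        * exp (sqn p a / (2 * (1 - c))
            + d * sqn r (tmul p Q a) / (2 * (1 - c)\<^sup>2 * (1 - d / (1 - c)))))" (is "?L = _")
proof -
  \<comment> \<open>After x is integrated out, z is left with quadratic coefficient e and linear
    coefficient b, while K collects what is free of z.\<close>
  define e K where "e = d / (1 - c)" and "K = (1 / sqrt (1 - c)) ^ p * exp (sqn p a / (2 * (1 - c)))"
  define b where "b k = sqrt d / (1 - c) * tmul p Q a k" for k
  have K: "K \<ge> 0" using c by (simp add: K_def)
  have [measurable]: "(\<lambda>(x, z). exp (c / 2 * sqn p x + (\<Sum>j<p. (a j + sqrt d * mul r Q z j) * x j)))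
      \<in> borel_measurable (euclid_space p \<Otimes>\<^sub>M euclid_space r)"
    unfolding mul_def sqn_def by measurable
  interpret P: pair_sigma_finite "std_normal r" "std_normal p"
    by (simp add: pair_sigma_finite_def sigma_finite_std_normal)
  note lin = sum_scaled_mul_eq_sum_scaled_tmul[where s = "sqrt d"]
  have "?L = (\<integral>\<^sup>+x. (\<integral>\<^sup>+z. ennreal (exp (c / 2 * sqn p x
        + (\<Sum>j<p. (a j + sqrt d * mul r Q z j) * x j))) \<partial>std_normal r) \<partial>std_normal p)"
  proof (intro nn_integral_cong)
    fix x
    \<comment> \<open>The term \<open>0 / 2 * sqn r z\<close> brings the integrand to the shape of
      \<open>nn_integral_std_normal_exp_quad\<close> with coefficient 0.\<close>
    have "(\<integral>\<^sup>+z. ennreal (exp (c / 2 * sqn p x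
        + (\<Sum>j<p. (a j + sqrt d * mul r Q z j) * x j))) \<partial>std_normal r)
      = (\<integral>\<^sup>+z. ennreal (exp (c / 2 * sqn p x + (\<Sum>j<p. a j * x j)))
          * ennreal (exp (0 / 2 * sqn r z + (\<Sum>k<r. sqrt d * tmul p Q x k * z k))) \<partial>std_normal r)"
    proof (intro nn_integral_cong)
      fix z
      have "c / 2 * sqn p x + (\<Sum>j<p. (a j + sqrt d * mul r Q z j) * x j)
          = (c / 2 * sqn p x + (\<Sum>j<p. a j * x j)) + (0 / 2 * sqn r z + (\<Sum>k<r. sqrt d * tmul p Q x k * z k))"
        by (simp add: distrib_right sum.distrib lin)
      then show "ennreal (exp (c / 2 * sqn p x + (\<Sum>j<p. (a j + sqrt d * mul r Q z j) * x j)))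
          = ennreal (exp (c / 2 * sqn p x + (\<Sum>j<p. a j * x j)))
          * ennreal (exp (0 / 2 * sqn r z + (\<Sum>k<r. sqrt d * tmul p Q x k * z k)))"
        by (simp only: ennreal_exp_add mult.assoc)
    qed
    also have "\<dots> = ennreal (exp (c / 2 * sqn p x + (\<Sum>j<p. a j * x j)))
        * ennreal (exp (sqn r (\<lambda>k. sqrt d * tmul p Q x k) / 2))"
      using nn_integral_std_normal_exp_quad[of 0 r "\<lambda>k. sqrt d * tmul p Q x k"]
      by (subst nn_integral_cmult) auto
    also have "\<dots> = ennreal (exp (c / 2 * sqn p x + (\<Sum>j<p. a j * x j) + d / 2 * sqn r (tmul p Q x)))"
      using d by (simp add: exp_add ennreal_mult' sqn_scale)
    finally show "ennreal (exp (c / 2 * sqn p x + (\<Sum>j<p. a j * x j) + d / 2 * sqn r (tmul p Q x)))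
      = (\<integral>\<^sup>+z. ennreal (exp (c / 2 * sqn p x
        + (\<Sum>j<p. (a j + sqrt d * mul r Q z j) * x j))) \<partial>std_normal r)" by simp
  qed
  also have "\<dots> = (\<integral>\<^sup>+z. (\<integral>\<^sup>+x. ennreal (exp (c / 2 * sqn p x
        + (\<Sum>j<p. (a j + sqrt d * mul r Q z j) * x j))) \<partial>std_normal p) \<partial>std_normal r)"
    by (subst P.Fubini') (auto simp: case_prod_beta)
  also have "\<dots> = (\<integral>\<^sup>+z. ennreal K * ennreal (exp (e / 2 * sqn r z + (\<Sum>k<r. b k * z k))) \<partial>std_normal r)"
  proof (intro nn_integral_cong)
    fix z
    \<comment> \<open>Since |Qz| = |z|, the squared norm of a + sqrt(d) Qz is |a|^2 + d|z|^2 plus a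
      cross term linear in z, in which a enters through Q'a.\<close>
    have "sqn p (\<lambda>j. a j + sqrt d * mul r Q z j) / (2 * (1 - c))
        = sqn p a / (2 * (1 - c)) + (e / 2 * sqn r z + (\<Sum>k<r. b k * z k))"
    proof -
      have S: "(\<Sum>k<r. b k * z k) = sqrt d / (1 - c) * (\<Sum>k<r. tmul p Q a k * z k)"
        unfolding b_def by (simp add: sum_distrib_left mult.assoc)
      have "(A + d * n + 2 * s * B) / (2 * u) = A / (2 * u) + (d / u / 2 * n + s / u * B)"
        if "u > 0" for A n s B u :: real
        using that by (simp add: field_simps)
      from this[of "1 - c"] show ?thesis
        unfolding sqn_add_mul[OF Q] S e_def using c d(1) by simp
    qed
    then have "(1 / sqrt (1 - c)) ^ p * exp (sqn p (\<lambda>j. a j + sqrt d * mul r Q z j) / (2 * (1 - c)))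
        = K * exp (e / 2 * sqn r z + (\<Sum>k<r. b k * z k))"
      by (simp only: K_def exp_add mult.assoc)
    then show "(\<integral>\<^sup>+x. ennreal (exp (c / 2 * sqn p x
        + (\<Sum>j<p. (a j + sqrt d * mul r Q z j) * x j))) \<partial>std_normal p)
      = ennreal K * ennreal (exp (e / 2 * sqn r z + (\<Sum>k<r. b k * z k)))"
      by (simp only: nn_integral_std_normal_exp_quad[OF c] ennreal_mult'[OF K])
  qed
  also have "\<dots> = ennreal K * ennreal ((1 / sqrt (1 - e)) ^ r * exp (sqn r b / (2 * (1 - e))))"
    using d nn_integral_std_normal_exp_quad[of e r b] by (subst nn_integral_cmult) (auto simp: e_def)
  also have "sqn r b / (2 * (1 - e)) = d * sqn r (tmul p Q a) / (2 * (1 - c)\<^sup>2 * (1 - e))"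
    using d unfolding b_def sqn_scale by (simp add: power_divide)
  finally show ?thesis
    using K d by (simp add: e_def K_def ennreal_mult'[symmetric] exp_add algebra_simps)
qed

section \<open>The spiked normal law\<close>

text \<open>Sylvester's determinant identity. \<open>N * M\<close> and \<open>M * N\<close> are both
  block triangular, with determinants det(I + eQQ') and det(I + eQ'Q) = (1+e)^r, and the determinant
  is multiplicative.\<close>

lemma det_one_plus_outer:
  fixes Q :: "real mat"
  assumes Q: "Q \<in> stiefel p r"
  shows "Determinant.det (1\<^sub>m p + e \<cdot>\<^sub>m (Q * transpose_mat Q)) = (1 + e) ^ r"
proof -
  have Qc: "Q \<in> carrier_mat p r" and QQ: "transpose_mat Q * Q = 1\<^sub>m r"
    using Q by (auto simp: stiefel_def)
  have Tc: "transpose_mat Q \<in> carrier_mat r p" using Qc by simp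
  define M where "M = four_block_mat (1\<^sub>m p) (- Q) (e \<cdot>\<^sub>m transpose_mat Q) (1\<^sub>m r)"
  define N where "N = four_block_mat (1\<^sub>m p) Q (0\<^sub>m r p) (1\<^sub>m r)"
  have M: "M \<in> carrier_mat (p + r) (p + r)" and N: "N \<in> carrier_mat (p + r) (p + r)"
    using Qc by (auto simp: M_def N_def)
  have dN: "Determinant.det N = 1"
    unfolding N_def using Qc by (subst det_four_block_mat_lower_left_zero[of _ p _ r]) auto
  have "Q + - Q = 0\<^sub>m p r" "- Q + Q = 0\<^sub>m p r" using Qc by (auto intro!: eq_matI)
  have e1: "N * M = four_block_mat (1\<^sub>m p + e \<cdot>\<^sub>m (Q * transpose_mat Q)) (0\<^sub>m p r) (e \<cdot>\<^sub>m transpose_mat Q) (1\<^sub>m r)"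
    unfolding M_def N_def using Qc Tc
    apply (subst mult_four_block_mat[of _ p p _ r _ r _ _ p _ r])
    apply (auto simp: \<open>- Q + Q = 0\<^sub>m p r\<close> left_mult_zero_mat[of _ p])
    done
  have e2: "M * N = four_block_mat (1\<^sub>m p) (0\<^sub>m p r) (e \<cdot>\<^sub>m transpose_mat Q) ((1 + e) \<cdot>\<^sub>m 1\<^sub>m r)"
    unfolding M_def N_def using Qc Tc
    apply (subst mult_four_block_mat[of _ p p _ r _ r _ _ p _ r])
    apply (auto simp: \<open>Q + - Q = 0\<^sub>m p r\<close> QQ mult_smult_assoc_mat[of _ r p _ r])
    done
  have "Determinant.det (1\<^sub>m p + e \<cdot>\<^sub>m (Q * transpose_mat Q)) = Determinant.det (N * M)"
    unfolding e1 using Qc by (subst det_four_block_mat_upper_right_zero[of _ p _ r]) auto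
  also have "\<dots> = Determinant.det (M * N)"
    using M N by (simp add: Determinant.det_mult)
  also have "\<dots> = (1 + e) ^ r"
    unfolding e2 using Qc by (subst det_four_block_mat_upper_right_zero[of _ p _ r]) auto
  finally show ?thesis .
qed

text \<open>The output of the elimination behind \<open>mat_inverse\<close> is identified
  indirectly: A is a unit, hence some inverse C is returned, and C = (BA)C = B(AC) = B.\<close>

lemma mat_inverse_eqI:
  fixes A :: "real mat"
  assumes A: "A \<in> carrier_mat n n" and B: "B \<in> carrier_mat n n" and AB: "A * B = 1\<^sub>m n"
  shows "mat_inverse A = Some B"
proof -
  have BA: "B * A = 1\<^sub>m n" by (rule mat_mult_left_right_inverse[OF A B AB])
  have "A \<in> Units (ring_mat TYPE(real) n ())"
    using A B AB BA by (auto simp: Units_def ring_mat_simps)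
  then obtain C where C: "mat_inverse A = Some C"
    using mat_inverse(1)[OF A, of "()"] by (cases "mat_inverse A") auto
  then have "A * C = 1\<^sub>m n" "C \<in> carrier_mat n n" using mat_inverse(2)[OF A C] by auto
  then have "C = (B * A) * C" using BA by simp
  also have "\<dots> = B * (A * C)" using A B \<open>C \<in> _\<close> by (rule_tac assoc_mult_mat) auto
  finally show ?thesis using C \<open>A * C = _\<close> B by simp
qed

text \<open>With P = QQ' idempotent and e = d/(1-d), (I + eP)(I - dP) = I + (e - d - ed)P, and the
  coefficient of P vanishes.\<close>

lemma mat_inverse_spiked_cov:
  assumes Q: "Q \<in> stiefel p r" and d: "d \<noteq> 1"
  shows "mat_inverse (spiked_cov p d Q) = Some (1\<^sub>m p + (- d) \<cdot>\<^sub>m (Q * transpose_mat Q))"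
proof -
  have Qc: "Q \<in> carrier_mat p r" and QQ: "transpose_mat Q * Q = 1\<^sub>m r"
    using Q by (auto simp: stiefel_def)
  define P where "P = Q * transpose_mat Q"
  have P: "P \<in> carrier_mat p p" using Qc by (simp add: P_def)
  have "P * P = Q * (transpose_mat Q * (Q * transpose_mat Q))"
    unfolding P_def using Qc by (subst assoc_mult_mat[of _ p r _ p _ p]) auto
  also have "transpose_mat Q * (Q * transpose_mat Q) = (transpose_mat Q * Q) * transpose_mat Q"
    using Qc by (subst assoc_mult_mat[of _ r p _ r _ p]) auto
  also have "\<dots> = transpose_mat Q" using Qc by (simp add: QQ)
  finally have PP: "P * P = P" by (simp add: P_def)
  define e where "e = d / (1 - d)"
  have e: "e - d - e * d = 0" using d by (simp add: e_def field_simps)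
  have "(1\<^sub>m p + e \<cdot>\<^sub>m P) * (1\<^sub>m p + (- d) \<cdot>\<^sub>m P) = (1\<^sub>m p + e \<cdot>\<^sub>m P) * 1\<^sub>m p + (1\<^sub>m p + e \<cdot>\<^sub>m P) * ((- d) \<cdot>\<^sub>m P)"
    using P by (subst mult_add_distrib_mat[of _ p p _ p]) auto
  also have "(1\<^sub>m p + e \<cdot>\<^sub>m P) * ((- d) \<cdot>\<^sub>m P) = (- d) \<cdot>\<^sub>m ((1\<^sub>m p + e \<cdot>\<^sub>m P) * P)"
    using P by (subst mult_smult_distrib[of _ p p _ p]) auto
  also have "(1\<^sub>m p + e \<cdot>\<^sub>m P) * P = P + e \<cdot>\<^sub>m P"
    using P PP by (subst add_mult_distrib_mat[of _ p p _ _ p]) (auto simp: mult_smult_assoc_mat[of _ p p _ p])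
  also have "(1\<^sub>m p + e \<cdot>\<^sub>m P) * 1\<^sub>m p = 1\<^sub>m p + e \<cdot>\<^sub>m P" using P by simp
  also have "1\<^sub>m p + e \<cdot>\<^sub>m P + (- d) \<cdot>\<^sub>m (P + e \<cdot>\<^sub>m P) = 1\<^sub>m p"
  proof (rule eq_matI)
    fix i j assume ij: "i < dim_row (1\<^sub>m p)" "j < dim_col (1\<^sub>m p)"
    have "e * x + (- d) * (x + e * x) = 0" for x
      using arg_cong[OF e, of "\<lambda>t. t * x"] by (simp add: algebra_simps)
    from this[of "P $$ (i, j)"] show "(1\<^sub>m p + e \<cdot>\<^sub>m P + (- d) \<cdot>\<^sub>m (P + e \<cdot>\<^sub>m P)) $$ (i, j) = 1\<^sub>m p $$ (i, j)"
      using P ij by simp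
  qed (use P in auto)
  finally have "(1\<^sub>m p + e \<cdot>\<^sub>m P) * (1\<^sub>m p + (- d) \<cdot>\<^sub>m P) = 1\<^sub>m p" .
  then show ?thesis
    using P unfolding spiked_cov_def e_def[symmetric] P_def[symmetric]
    by (intro mat_inverse_eqI[of _ p]) auto
qed

text \<open>This is the quadratic form in the exponent of \<open>mvn\<close>; adjointness turns the
  inner product of x with QQ'x into |Q'x|^2.\<close>

lemma scalar_prod_spiked:
  assumes Q: "Q \<in> stiefel p r"
  shows "scalar_prod (Matrix.vec p x) ((1\<^sub>m p + (- d) \<cdot>\<^sub>m (Q * transpose_mat Q)) *\<^sub>v Matrix.vec p x)
    = sqn p x - d * sqn r (tmul p Q x)"
proof -
  have Qc: "Q \<in> carrier_mat p r" using Q by (auto simp: stiefel_def)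
  have "((1\<^sub>m p + (- d) \<cdot>\<^sub>m (Q * transpose_mat Q)) *\<^sub>v Matrix.vec p x) $ i
      = x i - d * mul r Q (tmul p Q x) i" if "i < p" for i
  proof -
    have "((1\<^sub>m p + (- d) \<cdot>\<^sub>m (Q * transpose_mat Q)) *\<^sub>v Matrix.vec p x) $ i
       = (\<Sum>j<p. ((if i = j then 1 else 0) - d * (\<Sum>k<r. Q $$ (i, k) * Q $$ (j, k))) * x j)"
      using that Qc
      by (simp add: scalar_prod_def lessThan_atLeast0 eq_commute[of _ i])
    also have "\<dots> = (\<Sum>j<p. (if i = j then x j else 0)) - d * (\<Sum>j<p. (\<Sum>k<r. Q $$ (i, k) * Q $$ (j, k)) * x j)"
      unfolding left_diff_distrib sum_subtractf
      by (simp add: sum_distrib_left[of d "\<lambda>j. _ j * x j"] mult.assoc if_distrib[of "\<lambda>t. t * _"] cong: if_cong)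
    also have "(\<Sum>j<p. (\<Sum>k<r. Q $$ (i, k) * Q $$ (j, k)) * x j) = mul r Q (tmul p Q x) i"
      unfolding mul_def tmul_def sum_distrib_left sum_distrib_right
      by (subst sum.swap) (simp add: mult.assoc)
    finally show ?thesis using that by simp
  qed
  then have "scalar_prod (Matrix.vec p x) ((1\<^sub>m p + (- d) \<cdot>\<^sub>m (Q * transpose_mat Q)) *\<^sub>v Matrix.vec p x)
     = (\<Sum>i<p. x i * (x i - d * mul r Q (tmul p Q x) i))"
    using Qc by (simp add: scalar_prod_def lessThan_atLeast0)
  also have "\<dots> = sqn p x - d * (\<Sum>i<p. x i * mul r Q (tmul p Q x) i)"
    by (simp add: sqn_def right_diff_distrib sum_subtractf sum_distrib_left power2_eq_square mult_ac)
  also have "(\<Sum>i<p. x i * mul r Q (tmul p Q x) i) = sqn r (tmul p Q x)"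
    unfolding sum_mul_eq_sum_tmul by (simp add: sqn_def power2_eq_square)
  finally show ?thesis .
qed

lemma std_normal_eq_density:
  "std_normal p = density (\<Pi>\<^sub>M j\<in>{..<p}. lborel) (\<lambda>x. ennreal (exp (- sqn p x / 2) / sqrt ((2 * pi) ^ p)))"
proof -
  have "std_normal p = density (\<Pi>\<^sub>M j\<in>{..<p}. lborel) (\<lambda>x. \<Prod>j<p. ennreal (std_normal_density (x j)))"
    unfolding std_normal_def
    by (intro PiM_density SN.product_sigma_finite_axioms)
      (auto simp: product_sigma_finite_def sigma_finite_lborel)
  also have "(\<lambda>x. \<Prod>j<p. ennreal (std_normal_density (x j)))
      = (\<lambda>x. ennreal (exp (- sqn p x / 2) / sqrt ((2 * pi) ^ p)))"
  proof
    fix x :: "nat \<Rightarrow> real"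
    have "(\<Prod>j<p. std_normal_density (x j)) = exp (- sqn p x / 2) / sqrt ((2 * pi) ^ p)"
      unfolding real_sqrt_power
      by (simp add: std_normal_density_def prod_dividef sqn_def
          sum_divide_distrib sum_negf flip: exp_sum)
    then show "(\<Prod>j<p. ennreal (std_normal_density (x j))) = ennreal (exp (- sqn p x / 2) / sqrt ((2 * pi) ^ p))"
      by (simp add: prod_ennreal)
  qed
  finally show ?thesis .
qed

text \<open>The likelihood ratio of N(0, (I - dQQ')^{-1}) to N(0, I) at one observation: the terms
  |x|^2 in the exponents cancel and the determinant gives the prefactor.\<close>

definition lik1 :: "nat \<Rightarrow> nat \<Rightarrow> real \<Rightarrow> real mat \<Rightarrow> (nat \<Rightarrow> real) \<Rightarrow> real" where
  "lik1 p r d Q x = sqrt (1 - d) ^ r * exp (d / 2 * sqn r (tmul p Q x))"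

lemma measurable_lik1 [measurable]: "lik1 p r d Q \<in> borel_measurable (euclid_space p)"
  unfolding lik1_def[abs_def] tmul_def sqn_def by measurable

lemma mvn_spiked_cov:
  assumes Q: "Q \<in> stiefel p r" and d: "d < 1"
  shows "mvn p (spiked_cov p d Q) = density (std_normal p) (\<lambda>x. ennreal (lik1 p r d Q x))"
proof -
  have det: "Determinant.det (spiked_cov p d Q) = (1 / (1 - d)) ^ r"
    using det_one_plus_outer[OF Q, of "d / (1 - d)"] d by (simp add: spiked_cov_def field_simps)
  have eq: "exp (- (sqn p x - d * sqn r (tmul p Q x)) / 2) / sqrt ((2 * pi) ^ p * (1 / (1 - d)) ^ r)
     = exp (- sqn p x / 2) / sqrt ((2 * pi) ^ p) * lik1 p r d Q x" for x
  proof -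
    have "exp (- (sqn p x - d * sqn r (tmul p Q x)) / 2) = exp (- sqn p x / 2) * exp (d / 2 * sqn r (tmul p Q x))"
      by (simp add: diff_divide_distrib flip: exp_add)
    then show ?thesis
      using d by (simp add: lik1_def real_sqrt_mult real_sqrt_power real_sqrt_divide power_one_over)
  qed
  have d': "d \<noteq> 1" using d by simp
  have "mvn p (spiked_cov p d Q) = density (\<Pi>\<^sub>M j\<in>{..<p}. lborel)
      (\<lambda>x. ennreal (exp (- sqn p x / 2) / sqrt ((2 * pi) ^ p)) * ennreal (lik1 p r d Q x))"
    unfolding mvn_def mat_inverse_spiked_cov[OF Q d'] det option.sel scalar_prod_spiked[OF Q] eq
    by (subst ennreal_mult') auto
  also have "\<dots> = density (std_normal p) (\<lambda>x. ennreal (lik1 p r d Q x))"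
    unfolding std_normal_eq_density by (subst density_density_eq) (auto simp: sqn_def)
  finally show ?thesis .
qed

lemma mvn_one: "mvn p (1\<^sub>m p) = std_normal p"
proof -
  \<comment> \<open>The identity covariance is the spiked one with d = 0 and an empty Q: a p x 0
    matrix trivially has orthonormal columns, and its likelihood ratio is 1.\<close>
  have Q: "0\<^sub>m p 0 \<in> stiefel p 0" by (auto simp: stiefel_def intro!: eq_matI)
  have "spiked_cov p 0 (0\<^sub>m p 0) = 1\<^sub>m p" by (auto simp: spiked_cov_def intro!: eq_matI)
  then have "mvn p (1\<^sub>m p) = density (std_normal p) (\<lambda>x. ennreal (lik1 p 0 0 (0\<^sub>m p 0) x))"
    using mvn_spiked_cov[OF Q, of 0] by simp
  also have "\<dots> = std_normal p" by (simp add: lik1_def density_1)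
  finally show ?thesis .
qed

section \<open>Data laws and the mixture likelihood ratio\<close>

lemma prob_space_densityI:
  assumes [measurable]: "f \<in> borel_measurable M" and "(\<integral>\<^sup>+x. f x \<partial>M) = 1"
  shows "prob_space (density M f)"
proof (rule prob_spaceI)
  have "emeasure (density M f) (space M) = (\<integral>\<^sup>+x. f x * indicator (space M) x \<partial>M)"
    by (rule emeasure_density) auto
  also have "\<dots> = (\<integral>\<^sup>+x. f x \<partial>M)" by (intro nn_integral_cong) simp
  finally show "emeasure (density M f) (space (density M f)) = 1" using assms(2) by simp
qed

lemma null_law_eq: "null_law n p = (\<Pi>\<^sub>M i\<in>{..<n}. std_normal p)"
  by (simp add: null_law_def mvn_one)

lemma sets_null_law [measurable_cong, simp]: "sets (null_law n p) = sets (data_space n p)"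
  unfolding null_law_eq by (rule sets_PiM_cong) auto

lemma space_null_law [simp]: "space (null_law n p) = space (data_space n p)"
  by (rule sets_eq_imp_space_eq) simp

lemma prob_space_null_law: "prob_space (null_law n p)"
  unfolding null_law_eq by (intro prob_space_PiM prob_space_std_normal)

lemma sigma_finite_null_law: "sigma_finite_measure (null_law n p)"
  using prob_space_null_law by (rule prob_space_imp_sigma_finite)

lemma product_sigma_finite_std_normal: "product_sigma_finite (\<lambda>_. std_normal p)"
  by (simp add: product_sigma_finite_def sigma_finite_std_normal)

lemma nn_integral_null_law_prod:
  assumes "f \<in> borel_measurable (euclid_space p)"
  shows "(\<integral>\<^sup>+X. (\<Prod>i<n. f (X i)) \<partial>null_law n p) = (\<integral>\<^sup>+x. f x \<partial>std_normal p) ^ n"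
proof -
  interpret product_sigma_finite "\<lambda>_::nat. std_normal p" by (rule product_sigma_finite_std_normal)
  show ?thesis
    unfolding null_law_eq using assms by (subst product_nn_integral_prod) auto
qed

definition lik :: "nat \<Rightarrow> nat \<Rightarrow> nat \<Rightarrow> real \<Rightarrow> real mat \<Rightarrow> (nat \<Rightarrow> nat \<Rightarrow> real) \<Rightarrow> real" where
  "lik n p r d Q X = (\<Prod>i<n. lik1 p r d Q (X i))"

lemma lik1_nonneg: "d \<le> 1 \<Longrightarrow> 0 \<le> lik1 p r d Q x"
  by (simp add: lik1_def)

lemma nn_integral_lik1:
  assumes Q: "Q \<in> stiefel p r" and d: "0 \<le> d" "d < 1"
  shows "(\<integral>\<^sup>+x. ennreal (lik1 p r d Q x) \<partial>std_normal p) = 1"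
proof -
  have "(\<integral>\<^sup>+x. ennreal (lik1 p r d Q x) \<partial>std_normal p)
      = ennreal (sqrt (1 - d) ^ r) * (\<integral>\<^sup>+x. ennreal (exp (d / 2 * sqn r (tmul p Q x))) \<partial>std_normal p)"
    using d unfolding lik1_def
    by (subst nn_integral_cmult[symmetric]) (auto simp: ennreal_mult' sqn_def)
  also have "(\<integral>\<^sup>+x. ennreal (exp (d / 2 * sqn r (tmul p Q x))) \<partial>std_normal p)
      = ennreal ((1 / sqrt (1 - d)) ^ r)"
    using nn_integral_std_normal_exp_proj[OF Q, of 0 d "\<lambda>_. 0"] d
    by simp
  also have "ennreal (sqrt (1 - d) ^ r) * ennreal ((1 / sqrt (1 - d)) ^ r) = 1"
    using d by (simp add: ennreal_mult'[symmetric] power_mult_distrib[symmetric])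
  finally show ?thesis .
qed

text \<open>\<open>PiM_density\<close> needs sigma-finite factors; each factor is a probability
  measure because \<open>lik1\<close> integrates to 1.\<close>

lemma PiM_mvn_spiked_cov:
  assumes Q: "Q \<in> stiefel p r" and d: "0 \<le> d" "d < 1"
  shows "(\<Pi>\<^sub>M i\<in>{..<n}. mvn p (spiked_cov p d Q)) = density (null_law n p) (\<lambda>X. ennreal (lik n p r d Q X))"
proof -
  have "prob_space (density (std_normal p) (\<lambda>x. ennreal (lik1 p r d Q x)))"
    by (rule prob_space_densityI) (use nn_integral_lik1[OF assms] in auto)
  then have "product_sigma_finite (\<lambda>i::nat. density (std_normal p) (\<lambda>x. ennreal (lik1 p r d Q x)))"
    by (simp add: product_sigma_finite_def prob_space_imp_sigma_finite)
  then show ?thesis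
    unfolding mvn_spiked_cov[OF Q d(2)] null_law_eq lik_def
    using d by (subst PiM_density) (auto simp: product_sigma_finite_std_normal prod_ennreal lik1_nonneg)
qed

lemma measurable_stiefel_entry:
  assumes "j < p" "k < r"
  shows "(\<lambda>Q. Q $$ (j, k)) \<in> borel_measurable (stiefel_borel p r)"
proof -
  have "(\<lambda>Q. \<lambda>ij\<in>{..<p} \<times> {..<r}. Q $$ ij) \<in> measurable (stiefel_borel p r) (\<Pi>\<^sub>M ij\<in>{..<p} \<times> {..<r}. borel :: real measure)"
    unfolding stiefel_borel_def by (rule measurable_vimage_algebra1) (auto simp: space_PiM)
  then have "(\<lambda>Q. (\<lambda>ij\<in>{..<p} \<times> {..<r}. Q $$ ij) (j, k)) \<in> borel_measurable (stiefel_borel p r)"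
    by (rule measurable_compose) (rule measurable_component_singleton, use assms in auto)
  then show ?thesis using assms by simp
qed

section \<open>Mixing over the prior on the Stiefel manifold\<close>

locale uniform_prior =
  fixes p r :: nat and U :: "real mat measure"
  assumes uniform: "uniform_stiefel p r U"
begin

sublocale U: prob_space U
  using uniform by (simp add: uniform_stiefel_def)

lemma sets_U [measurable_cong]: "sets U = sets (stiefel_borel p r)"
  using uniform by (simp add: uniform_stiefel_def)

lemma space_U: "space U = stiefel p r"
  using sets_eq_imp_space_eq[OF sets_U] by (simp add: stiefel_borel_def)

lemma measurable_entry: "j < p \<Longrightarrow> k < r \<Longrightarrow> (\<lambda>Q. Q $$ (j, k)) \<in> borel_measurable U"
  using measurable_stiefel_entry by (simp add: measurable_cong_sets[OF sets_U refl])

text \<open>Tonelli's theorem needs joint measurability in Q and X; it holds because the ratio is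
  built from finitely many matrix entries and data coordinates.\<close>

lemma measurable_lik [measurable]:
  "(\<lambda>(Q, X). lik n p r d Q X) \<in> borel_measurable (U \<Otimes>\<^sub>M data_space n p)"
proof -
  have [measurable]: "(\<lambda>\<omega>. fst \<omega> $$ (j, k)) \<in> borel_measurable (U \<Otimes>\<^sub>M data_space n p)"
    if "j < p" "k < r" for j k
    using measurable_compose[OF measurable_fst measurable_entry[OF that]] .
  have [measurable]: "(\<lambda>\<omega>. snd \<omega> i j) \<in> borel_measurable (U \<Otimes>\<^sub>M data_space n p)"
    if "i < n" "j < p" for i j
    using that by (intro measurable_compose[OF measurable_compose[OF measurable_snd
            measurable_component_singleton[of i]] measurable_component_singleton[of j]]) auto
  show ?thesis
    unfolding lik_def lik1_def sqn_def tmul_def case_prod_beta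
    by (intro borel_measurable_prod borel_measurable_times borel_measurable_const borel_measurable_sum
        borel_measurable_power borel_measurable_exp) simp_all
qed

lemma measurable_lik_data [measurable]:
  "Q \<in> stiefel p r \<Longrightarrow> lik n p r d Q \<in> borel_measurable (data_space n p)"
  using measurable_Pair2[OF measurable_lik, of Q] by (simp add: space_U)

lemma nn_integral_lik:
  assumes "Q \<in> stiefel p r" "0 \<le> d" "d < 1"
  shows "(\<integral>\<^sup>+X. ennreal (lik n p r d Q X) \<partial>null_law n p) = 1"
  using nn_integral_null_law_prod[of "\<lambda>x. ennreal (lik1 p r d Q x)" p n] assms
  by (simp add: nn_integral_lik1 lik_def prod_ennreal lik1_nonneg)

text \<open>Valued in the extended nonnegative reals, so that it can be handled before any
  finiteness is known.\<close>

definition mix_lik :: "nat \<Rightarrow> real \<Rightarrow> (nat \<Rightarrow> nat \<Rightarrow> real) \<Rightarrow> ennreal" where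
  "mix_lik n d X = (\<integral>\<^sup>+Q. ennreal (lik n p r d Q X) \<partial>U)"

lemma measurable_mix_lik [measurable]: "mix_lik n d \<in> borel_measurable (data_space n p)"
proof -
  have "(\<lambda>(X, Q). ennreal (lik n p r d Q X)) \<in> borel_measurable (data_space n p \<Otimes>\<^sub>M U)"
    using measurable_lik[THEN measurable_pair_swap] by (simp add: case_prod_beta)
  then show ?thesis
    unfolding mix_lik_def[abs_def] by (rule U.borel_measurable_nn_integral)
qed

lemma Fubini_U:
  assumes "sigma_finite_measure M" "(\<lambda>(Q, X). f Q X) \<in> borel_measurable (U \<Otimes>\<^sub>M M)"
  shows "(\<integral>\<^sup>+X. \<integral>\<^sup>+Q. f Q X \<partial>U \<partial>M) = (\<integral>\<^sup>+Q. \<integral>\<^sup>+X. f Q X \<partial>M \<partial>U)"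
proof -
  interpret P: pair_sigma_finite U M
    using assms(1) by (simp add: pair_sigma_finite_def U.sigma_finite_measure_axioms)
  show ?thesis using assms(2) by (rule P.Fubini')
qed

lemma Fubini_null_law:
  assumes "(\<lambda>(Q, X). f Q X) \<in> borel_measurable (U \<Otimes>\<^sub>M data_space n m)"
  shows "(\<integral>\<^sup>+X. \<integral>\<^sup>+Q. f Q X \<partial>U \<partial>null_law n m) = (\<integral>\<^sup>+Q. \<integral>\<^sup>+X. f Q X \<partial>null_law n m \<partial>U)"
  using assms by (intro Fubini_U sigma_finite_null_law)
    (simp add: measurable_cong_sets[OF sets_pair_measure_cong[OF refl sets_null_law] refl])

lemma Fubini_std_normal:
  assumes "(\<lambda>(Q, x). f Q x) \<in> borel_measurable (U \<Otimes>\<^sub>M euclid_space m)"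
  shows "(\<integral>\<^sup>+x. \<integral>\<^sup>+Q. f Q x \<partial>U \<partial>std_normal m) = (\<integral>\<^sup>+Q. \<integral>\<^sup>+x. f Q x \<partial>std_normal m \<partial>U)"
  using assms by (intro Fubini_U sigma_finite_std_normal)
    (simp add: measurable_cong_sets[OF sets_pair_measure_cong[OF refl sets_std_normal] refl])

text \<open>The probability of an event under the mixture is the average over Q of its conditional
  probabilities; Tonelli moves that average inside the integral over the null law.\<close>

lemma alt_law_eq_density:
  assumes d: "0 \<le> d" "d < 1"
  shows "alt_law n p d U = density (null_law n p) (mix_lik n d)"
proof -
  let ?K = "\<lambda>Q. \<Pi>\<^sub>M i\<in>{..<n}. mvn p (spiked_cov p d Q)"
  have K: "?K Q = density (null_law n p) (\<lambda>X. ennreal (lik n p r d Q X))" if "Q \<in> space U" for Q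
    using PiM_mvn_spiked_cov[OF _ d] that by (simp add: space_U)
  have em: "emeasure (?K Q) A = (\<integral>\<^sup>+X. ennreal (lik n p r d Q X) * indicator A X \<partial>null_law n p)"
    if "Q \<in> space U" "A \<in> sets (data_space n p)" for Q A
    using that measurable_lik_data[of Q n d] by (simp add: K emeasure_density space_U)
  \<comment> \<open>\<open>emeasure_bind\<close> requires the conditional laws to form a measurable
    kernel of subprobability measures.\<close>
  have meas: "?K \<in> measurable U (subprob_algebra (data_space n p))"
  proof (rule measurable_subprob_algebra)
    fix Q assume Q: "Q \<in> space U"
    show "sets (?K Q) = sets (data_space n p)" by (simp add: K[OF Q])
    have "prob_space (?K Q)"
      using Q nn_integral_lik[of Q d n] d
      unfolding K[OF Q] by (intro prob_space_densityI) (auto simp: space_U)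
    then show "subprob_space (?K Q)" by (rule prob_space_imp_subprob_space)
  next
    fix A assume A [measurable]: "A \<in> sets (data_space n p)"
    have "(\<lambda>(Q, X). ennreal (lik n p r d Q X) * indicator A X) \<in> borel_measurable (U \<Otimes>\<^sub>M null_law n p)"
      by measurable
    then have "(\<lambda>Q. \<integral>\<^sup>+X. ennreal (lik n p r d Q X) * indicator A X \<partial>null_law n p) \<in> borel_measurable U"
      by (rule sigma_finite_measure.borel_measurable_nn_integral[OF sigma_finite_null_law])
    then show "(\<lambda>Q. emeasure (?K Q) A) \<in> borel_measurable U"
      using em[OF _ A] by (simp cong: measurable_cong)
  qed
  show ?thesis
  proof (rule measure_eqI)
    show s: "sets (alt_law n p d U) = sets (density (null_law n p) (mix_lik n d))"
      unfolding alt_law_def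
      by (subst sets_bind[where N = "data_space n p"]) (auto simp: K U.not_empty)
    fix A assume "A \<in> sets (alt_law n p d U)"
    then have A [measurable]: "A \<in> sets (data_space n p)" using s by simp
    have "emeasure (alt_law n p d U) A
        = (\<integral>\<^sup>+Q. \<integral>\<^sup>+X. ennreal (lik n p r d Q X) * indicator A X \<partial>null_law n p \<partial>U)"
      unfolding alt_law_def emeasure_bind[OF U.not_empty meas A]
      using em[OF _ A] by (intro nn_integral_cong) auto
    also have "\<dots> = (\<integral>\<^sup>+X. \<integral>\<^sup>+Q. ennreal (lik n p r d Q X) * indicator A X \<partial>U \<partial>null_law n p)"
      by (subst Fubini_null_law) auto
    also have "\<dots> = (\<integral>\<^sup>+X. mix_lik n d X * indicator A X \<partial>null_law n p)"
    proof (intro nn_integral_cong)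
      fix X assume "X \<in> space (null_law n p)"
      then have "(\<lambda>Q. lik n p r d Q X) \<in> borel_measurable U"
        using measurable_Pair1[OF measurable_lik[of n d], of X] by simp
      then show "(\<integral>\<^sup>+Q. ennreal (lik n p r d Q X) * indicator A X \<partial>U) = mix_lik n d X * indicator A X"
        unfolding mix_lik_def by (subst nn_integral_multc) auto
    qed
    also have "\<dots> = emeasure (density (null_law n p) (mix_lik n d)) A"
      by (subst emeasure_density) auto
    finally show "emeasure (alt_law n p d U) A = emeasure (density (null_law n p) (mix_lik n d)) A" .
  qed
qed

lemma nn_integral_alt_law:
  assumes d: "0 \<le> d" "d < 1" and f [measurable]: "f \<in> borel_measurable (data_space n p)"
  shows "(\<integral>\<^sup>+X. f X \<partial>alt_law n p d U)
    = (\<integral>\<^sup>+Q. \<integral>\<^sup>+X. ennreal (lik n p r d Q X) * f X \<partial>null_law n p \<partial>U)"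
proof -
  have "(\<integral>\<^sup>+X. f X \<partial>alt_law n p d U) = (\<integral>\<^sup>+X. mix_lik n d X * f X \<partial>null_law n p)"
    unfolding alt_law_eq_density[OF d] by (subst nn_integral_density) auto
  also have "\<dots> = (\<integral>\<^sup>+X. \<integral>\<^sup>+Q. ennreal (lik n p r d Q X) * f X \<partial>U \<partial>null_law n p)"
  proof (intro nn_integral_cong)
    fix X assume "X \<in> space (null_law n p)"
    then have "(\<lambda>Q. lik n p r d Q X) \<in> borel_measurable U"
      using measurable_Pair1[OF measurable_lik[of n d], of X] by simp
    then show "mix_lik n d X * f X = (\<integral>\<^sup>+Q. ennreal (lik n p r d Q X) * f X \<partial>U)"
      unfolding mix_lik_def by (subst nn_integral_multc) auto
  qed
  also have "\<dots> = (\<integral>\<^sup>+Q. \<integral>\<^sup>+X. ennreal (lik n p r d Q X) * f X \<partial>null_law n p \<partial>U)"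
    by (subst Fubini_null_law) auto
  finally show ?thesis .
qed

lemma nn_integral_mix_lik:
  assumes d: "0 \<le> d" "d < 1"
  shows "(\<integral>\<^sup>+X. mix_lik n d X \<partial>null_law n p) = 1"
proof -
  have "(\<integral>\<^sup>+X. mix_lik n d X \<partial>null_law n p)
      = (\<integral>\<^sup>+Q. \<integral>\<^sup>+X. ennreal (lik n p r d Q X) \<partial>null_law n p \<partial>U)"
    unfolding mix_lik_def by (rule Fubini_null_law) auto
  also have "\<dots> = (\<integral>\<^sup>+Q. 1 \<partial>U)"
    using nn_integral_lik[OF _ d] by (intro nn_integral_cong) (simp add: space_U)
  finally show ?thesis by (simp add: U.emeasure_space_1)
qed

lemma prob_space_alt_law:
  assumes d: "0 \<le> d" "d < 1"
  shows "prob_space (alt_law n p d U)"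
  unfolding alt_law_eq_density[OF d]
  by (intro prob_space_densityI nn_integral_mix_lik[OF d]) auto

text \<open>With L the mixed likelihood ratio, power minus level is E[(L-1)\<open>\<phi>\<close>] <=
  E|L-1| under the null law. The inequality 2|L-1| <= e + (L-1)^2/e and E(L-1)^2 = E L^2 - 1 <= e^2
  then bound it by e.\<close>

lemma error_sum_ge:
  assumes d: "0 \<le> d" "d < 1" and e: "e > 0"
    and sq: "(\<integral>\<^sup>+X. (mix_lik n d X)\<^sup>2 \<partial>null_law n p) \<le> ennreal (1 + e\<^sup>2)"
    and \<phi>: "\<phi> \<in> tests n p"
  shows "1 - e \<le> error_sum n p d U \<phi>"
proof -
  interpret N: prob_space "null_law n p" by (rule prob_space_null_law)
  have m [measurable]: "\<phi> \<in> borel_measurable (data_space n p)"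
    and b: "\<And>X. X \<in> space (data_space n p) \<Longrightarrow> 0 \<le> \<phi> X \<and> \<phi> X \<le> 1"
    using \<phi> by (auto simp: tests_def)
  \<comment> \<open>\<open>enn2real\<close> sends infinity to 0, which is harmless: the mixed ratio
    has integral 1 and so is finite almost everywhere.\<close>
  define L where "L X = enn2real (mix_lik n d X)" for X
  have L [measurable]: "L \<in> borel_measurable (data_space n p)" unfolding L_def[abs_def] by measurable
  have L0: "0 \<le> L X" for X by (simp add: L_def)
  have "AE X in null_law n p. mix_lik n d X \<noteq> \<infinity>"
    by (rule nn_integral_PInf_AE) (auto simp: nn_integral_mix_lik[OF d])
  then have AE: "AE X in null_law n p. mix_lik n d X = ennreal (L X)"
    by eventually_elim (auto simp: L_def less_top)
  have alt: "alt_law n p d U = density (null_law n p) (\<lambda>X. ennreal (L X))"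
    unfolding alt_law_eq_density[OF d] using AE by (intro density_cong) auto
  have nL: "(\<integral>\<^sup>+X. ennreal (L X) \<partial>null_law n p) = 1"
    using nn_integral_cong_AE[OF AE] by (simp add: nn_integral_mix_lik[OF d])
  have iL: "integrable (null_law n p) L" 
    using nL L0 by (intro integrableI_nonneg) auto
  have EL: "(\<integral>X. L X \<partial>null_law n p) = 1"
    using nL L0 by (subst integral_eq_nn_integral) auto
  have "(\<integral>\<^sup>+X. ennreal ((L X)\<^sup>2) \<partial>null_law n p) = (\<integral>\<^sup>+X. (mix_lik n d X)\<^sup>2 \<partial>null_law n p)"
    using AE by (intro nn_integral_cong_AE, eventually_elim) (simp add: L0 ennreal_power)
  then have nL2: "(\<integral>\<^sup>+X. ennreal ((L X)\<^sup>2) \<partial>null_law n p) \<le> ennreal (1 + e\<^sup>2)" using sq by simp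
  have iL2: "integrable (null_law n p) (\<lambda>X. (L X)\<^sup>2)"
    using nL2 by (intro integrableI_nonneg) (auto intro: le_less_trans)
  have EL2: "(\<integral>X. (L X)\<^sup>2 \<partial>null_law n p) \<le> 1 + e\<^sup>2"
    using nL2 by (subst integral_eq_nn_integral) (auto intro: enn2real_leI)
  have i\<phi>: "integrable (null_law n p) \<phi>"
    using b by (intro N.integrable_const_bound[of _ 1]) (auto intro!: AE_I2)
  have iL\<phi>: "integrable (null_law n p) (\<lambda>X. L X * \<phi> X)"
    by (rule Bochner_Integration.integrable_bound[OF iL])
      (use b L0 in \<open>auto intro!: AE_I2 mult_left_le simp: abs_mult\<close>)
  have "test_power n p d U \<phi> - test_level n p \<phi> = (\<integral>X. L X * \<phi> X - \<phi> X \<partial>null_law n p)"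
    unfolding test_power_def test_level_def rejection_prob_def alt
    using L0 iL\<phi> i\<phi> by (subst integral_density) auto
  \<comment> \<open>The square is expanded so that E L = 1 and the bound on E L^2 can be inserted by
    linearity.\<close>
  also have "\<dots> \<le> (\<integral>X. (e + ((L X)\<^sup>2 - 2 * L X + 1) / e) / 2 \<partial>null_law n p)"
  proof (rule integral_mono)
    fix X assume "X \<in> space (null_law n p)"
    then have "0 \<le> \<phi> X" "\<phi> X \<le> 1" using b by auto
    then have "(L X - 1) * \<phi> X \<le> \<bar>L X - 1\<bar> * \<phi> X" by (intro mult_right_mono) auto
    also have "\<dots> \<le> \<bar>L X - 1\<bar>" using \<open>\<phi> X \<le> 1\<close> by (intro mult_left_le) auto
    also have "\<dots> \<le> (e + (L X - 1)\<^sup>2 / e) / 2"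
    proof -
      have "0 \<le> (\<bar>L X - 1\<bar> - e)\<^sup>2" by simp
      then have "2 * \<bar>L X - 1\<bar> * e \<le> e * e + (L X - 1)\<^sup>2"
        by (simp add: power2_diff power2_eq_square algebra_simps)
      then show ?thesis using e by (simp add: field_simps)
    qed
    finally show "L X * \<phi> X - \<phi> X \<le> (e + ((L X)\<^sup>2 - 2 * L X + 1) / e) / 2"
      by (simp add: power2_diff algebra_simps)
  qed (use iL iL2 iL\<phi> i\<phi> in auto)
  also have "\<dots> = (e + ((\<integral>X. (L X)\<^sup>2 \<partial>null_law n p) - 1) / e) / 2"
    using iL iL2 N.prob_space by (simp add: EL)
  also have "\<dots> \<le> (e + e\<^sup>2 / e) / 2"
    using EL2 e by (intro divide_right_mono add_left_mono) auto
  also have "\<dots> = e" using e by (simp add: power2_eq_square)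
  finally show ?thesis by (simp add: error_sum_def)
qed

end

section \<open>Orthogonal invariance of the prior\<close>

text \<open>The Householder reflection along v = y - y' swaps y and y' because their norms agree. If
  the vectors coincide, then v = 0 and the identity is taken instead.\<close>

lemma reflection_exists:
  assumes eq: "sqn p y = sqn p y'"
  obtains R where "R \<in> stiefel p p" "\<And>j. j < p \<Longrightarrow> tmul p R y j = y' j"
proof (cases "\<forall>j<p. y j = y' j")
  case True
  have "tmul p (1\<^sub>m p) y j = y' j" if "j < p" for j
  proof -
    have "tmul p (1\<^sub>m p) y j = (\<Sum>i<p. if i = j then y i else 0)"
      unfolding tmul_def using that by (intro sum.cong) auto
    then show ?thesis using that True by simp
  qed
  moreover have "1\<^sub>m p \<in> stiefel p p" by (auto simp: stiefel_def)
  ultimately show ?thesis using that by blast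
next
  case False
  define v where "v j = y j - y' j" for j
  define s where "s = sqn p v"
  have s: "s > 0" using False sqn_eq_0[of p v] sqn_nonneg[of p v] unfolding s_def v_def
    by (metis less_eq_real_def right_minus_eq)
  define R where "R = Matrix.mat p p (\<lambda>(i, j). (if i = j then 1 else 0) - 2 / s * v i * v j)"
  have vv: "(\<Sum>j<p. v j * v j) = s" by (simp add: s_def sqn_def power2_eq_square)
  \<comment> \<open>Column i of R paired with x is coordinate i of the reflected x; this serves both
    for R'R = I and for the image of y.\<close>
  have ent: "(\<Sum>j<p. ((if j = i then 1 else 0) - 2 / s * v j * v i) * x j) = x i - 2 / s * v i * (\<Sum>j<p. v j * x j)"
    if "i < p" for i and x :: "nat \<Rightarrow> real"
  proof -
    have "(\<Sum>j<p. ((if j = i then 1 else 0) - 2 / s * v j * v i) * x j)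
        = (\<Sum>j<p. (if j = i then x j else 0) - 2 / s * v i * (v j * x j))"
      by (intro sum.cong) (auto simp: algebra_simps)
    also have "\<dots> = x i - 2 / s * v i * (\<Sum>j<p. v j * x j)"
      using that by (simp add: sum_subtractf sum_distrib_left sum_divide_distrib mult_ac)
    finally show ?thesis .
  qed
  have "transpose_mat R * R = 1\<^sub>m p"
  proof (rule eq_matI)
    fix i k assume ik: "i < dim_row (1\<^sub>m p)" "k < dim_col (1\<^sub>m p)"
    define x where "x j = (if j = k then 1 else 0) - 2 / s * v j * v k" for j
    have "(transpose_mat R * R) $$ (i, k) = (\<Sum>j<p. ((if j = i then 1 else 0) - 2 / s * v j * v i) * x j)"
      using ik by (simp add: R_def scalar_prod_def x_def lessThan_atLeast0)
    also have "\<dots> = x i - 2 / s * v i * (\<Sum>j<p. v j * x j)" using ik by (intro ent) simp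
    also have "(\<Sum>j<p. v j * x j) = (\<Sum>j<p. ((if j = k then 1 else 0) - 2 / s * v j * v k) * v j)"
      by (simp add: x_def mult.commute)
    also have "\<dots> = v k - 2 / s * v k * s" using ik by (subst ent) (simp_all add: vv)
    also have "x i - 2 / s * v i * (v k - 2 / s * v k * s) = (if i = k then 1 else 0)"
      using s by (simp add: x_def)
    finally show "(transpose_mat R * R) $$ (i, k) = 1\<^sub>m p $$ (i, k)" using ik by simp
  qed (auto simp: R_def)
  then have "R \<in> stiefel p p" by (auto simp: stiefel_def R_def)
  moreover have "tmul p R y i = y' i" if "i < p" for i
  proof -
    \<comment> \<open>By polarisation, equal norms give the inner product of v and y the value s/2,
      so the reflection subtracts exactly v from y.\<close>
    have "2 * (\<Sum>j<p. v j * y j) = s + (sqn p y - sqn p y')"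
      unfolding s_def sqn_def v_def sum_distrib_left sum_subtractf[symmetric] sum.distrib[symmetric]
      by (intro sum.cong) (auto simp: power2_eq_square algebra_simps)
    then have vy: "(\<Sum>j<p. v j * y j) = s / 2" using eq by simp
    have "tmul p R y i = (\<Sum>j<p. ((if j = i then 1 else 0) - 2 / s * v j * v i) * y j)"
      using that by (simp add: tmul_def R_def)
    also have "\<dots> = y i - v i" using that s by (subst ent) (simp_all add: vy)
    finally show ?thesis by (simp add: v_def)
  qed
  ultimately show ?thesis using that by blast
qed

lemma tmul_cong: "(\<And>j. j < p \<Longrightarrow> x j = y j) \<Longrightarrow> tmul p Q x = tmul p Q y"
  by (auto simp: tmul_def)

lemma tmul_mult_mat:
  assumes R: "R \<in> carrier_mat p p" and Q: "Q \<in> carrier_mat p r" and k: "k < r"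
  shows "tmul p (R * Q) y k = tmul p Q (tmul p R y) k"
proof -
  have "tmul p (R * Q) y k = (\<Sum>j<p. (\<Sum>l<p. R $$ (j, l) * Q $$ (l, k)) * y j)"
    unfolding tmul_def using R Q k
    by (intro sum.cong) (auto simp: scalar_prod_def lessThan_atLeast0)
  also have "\<dots> = tmul p Q (tmul p R y) k"
    unfolding tmul_def sum_distrib_left sum_distrib_right
    by (subst sum.swap) (simp add: mult_ac)
  finally show ?thesis .
qed

lemma stiefel_mult:
  assumes R: "R \<in> stiefel p p" and Q: "Q \<in> stiefel p r"
  shows "R * Q \<in> stiefel p r"
proof -
  have c: "R \<in> carrier_mat p p" "Q \<in> carrier_mat p r" "transpose_mat R * R = 1\<^sub>m p" "transpose_mat Q * Q = 1\<^sub>m r"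
    using R Q by (auto simp: stiefel_def)
  have "transpose_mat (R * Q) * (R * Q) = transpose_mat Q * (transpose_mat R * (R * Q))"
    using c by (simp add: transpose_mult[of _ p p _ r] assoc_mult_mat[of _ r p _ p _ r])
  also have "transpose_mat R * (R * Q) = (transpose_mat R * R) * Q"
    using c(1,2) by (simp add: assoc_mult_mat[of _ p p _ p _ r])
  finally show ?thesis using c by (auto simp: stiefel_def)
qed

text \<open>An explicit Jensen inequality: for p > 0 and g standard normal in R^p, the right side is
  the mean of exp(b|g|^2/(2p)), and |g|^2 has mean p. It follows from 1 - u <= exp(-u); for p = 0
  the hypothesis says b < 0.\<close>

lemma exp_half_le_power:
  assumes "b < real p"
  shows "exp (b / 2) \<le> (1 / sqrt (1 - b / real p)) ^ p"
proof (cases "p = 0")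
  case True then show ?thesis using assms by simp
next
  case False
  have pos: "1 - b / real p > 0" using False assms by (simp add: field_simps)
  have "1 - b / real p \<le> exp (- (b / real p))" using exp_ge_add_one_self[of "- (b / real p)"] by simp
  then have "sqrt (1 - b / real p) \<le> sqrt (exp (- (b / real p)))" by simp
  also have "\<dots> = exp (- (b / real p) / 2)"
    by (rule real_sqrt_unique) (simp_all flip: exp_of_nat_mult)
  finally have "sqrt (1 - b / real p) \<le> exp (- (b / real p) / 2)" .
  then have "1 / exp (- (b / real p) / 2) \<le> 1 / sqrt (1 - b / real p)"
    using pos by (intro divide_left_mono) auto
  then have "exp (b / real p / 2) \<le> 1 / sqrt (1 - b / real p)" by (simp add: exp_minus inverse_eq_divide)
  then have "exp (b / real p / 2) ^ p \<le> (1 / sqrt (1 - b / real p)) ^ p" by (intro power_mono) auto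
  then show ?thesis using False by (simp flip: exp_of_nat_mult)
qed

context uniform_prior
begin

lemma measurable_sqn_tmul [measurable (raw)]:
  assumes [measurable]: "f \<in> measurable N U" and g: "\<And>j. j < p \<Longrightarrow> (\<lambda>\<omega>. g \<omega> j) \<in> borel_measurable N"
  shows "(\<lambda>\<omega>. sqn r (tmul p (f \<omega>) (g \<omega>))) \<in> borel_measurable N"
proof -
  have "(\<lambda>\<omega>. f \<omega> $$ (j, k)) \<in> borel_measurable N" if "j < p" "k < r" for j k
    by (rule measurable_compose[OF assms(1) measurable_entry[OF that]])
  then show ?thesis
    unfolding sqn_def tmul_def using g
    by (intro borel_measurable_sum borel_measurable_power borel_measurable_times) auto
qed

lemma measurable_mult_left:
  assumes R: "R \<in> stiefel p p"
  shows "(\<lambda>Q. R * Q) \<in> measurable U U"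
proof -
  have "(\<lambda>Q. R * Q) \<in> measurable U (stiefel_borel p r)"
    unfolding stiefel_borel_def
  proof (rule measurable_vimage_algebra2)
    show "(\<lambda>Q. R * Q) \<in> space U \<rightarrow> stiefel p r" using stiefel_mult[OF R] by (auto simp: space_U)
    show "(\<lambda>Q. \<lambda>ij\<in>{..<p} \<times> {..<r}. (R * Q) $$ ij) \<in> measurable U (\<Pi>\<^sub>M ij\<in>{..<p} \<times> {..<r}. borel)"
    proof (rule measurable_restrict)
      fix ij assume "ij \<in> {..<p} \<times> {..<r}"
      then obtain j k where jk: "ij = (j, k)" "j < p" "k < r" by auto
      have "(R * Q) $$ ij = (\<Sum>l<p. R $$ (j, l) * Q $$ (l, k))" if "Q \<in> space U" for Q
        using that R jk by (auto simp: space_U stiefel_def scalar_prod_def lessThan_atLeast0)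
      moreover have "(\<lambda>Q. \<Sum>l<p. R $$ (j, l) * Q $$ (l, k)) \<in> borel_measurable U"
        using measurable_entry[OF _ jk(3)] by (intro borel_measurable_sum borel_measurable_times) auto
      ultimately show "(\<lambda>Q. (R * Q) $$ ij) \<in> borel_measurable U" by (simp cong: measurable_cong)
    qed
  qed
  then show ?thesis by (simp add: measurable_cong_sets[OF refl sets_U])
qed

text \<open>Invariance permits replacing Q by RQ, where R is orthogonal with R'y = y'; then (RQ)'y =
  Q'(R'y) = Q'y'.\<close>

lemma nn_integral_U_eq_of_norm_eq:
  assumes eq: "sqn p y = sqn p y'" and [measurable]: "g \<in> borel_measurable borel"
  shows "(\<integral>\<^sup>+Q. g (sqn r (tmul p Q y)) \<partial>U) = (\<integral>\<^sup>+Q. g (sqn r (tmul p Q y')) \<partial>U)"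
proof -
  obtain R where R: "R \<in> stiefel p p" "\<And>j. j < p \<Longrightarrow> tmul p R y j = y' j"
    using reflection_exists[OF eq] by blast
  have "(\<integral>\<^sup>+Q. g (sqn r (tmul p Q y)) \<partial>U) = (\<integral>\<^sup>+Q. g (sqn r (tmul p Q y)) \<partial>distr U U (\<lambda>Q. R * Q))"
    using uniform R(1) by (simp add: uniform_stiefel_def)
  also have "\<dots> = (\<integral>\<^sup>+Q. g (sqn r (tmul p (R * Q) y)) \<partial>U)"
    using measurable_mult_left[OF R(1)] by (subst nn_integral_distr) auto
  also have "\<dots> = (\<integral>\<^sup>+Q. g (sqn r (tmul p Q y')) \<partial>U)"
  proof (intro nn_integral_cong)
    fix Q assume "Q \<in> space U"
    then have "tmul p (R * Q) y k = tmul p Q y' k" if "k < r" for k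
      using that R tmul_mult_mat[of R p Q r k y] tmul_cong[of p "tmul p R y" y' Q]
      by (auto simp: space_U stiefel_def)
    then show "g (sqn r (tmul p (R * Q) y)) = g (sqn r (tmul p Q y'))"
      by (simp add: sqn_def)
  qed
  finally show ?thesis .
qed

text \<open>
  The integral over \<open>Q\<close> depends on \<open>y\<close> only through its norm. So, replacing \<open>y\<close> by a Gaussian
  vector whose mean squared norm is that of \<open>y\<close>, it can only grow by Jensen's inequality, and
  then the Gaussian integral can be evaluated for each \<open>Q\<close>.
\<close>

lemma nn_integral_U_exp_le:
  assumes y: "sqn p y < real p"
  shows "(\<integral>\<^sup>+Q. ennreal (exp (sqn r (tmul p Q y) / 2)) \<partial>U)
    \<le> ennreal ((1 / sqrt (1 - sqn p y / real p)) ^ r)"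
proof -
  define t where "t = sqn p y / real p"
  have p: "real p > 0" using y sqn_nonneg[of p y] by linarith
  have t: "0 \<le> t" "t < 1" using y p by (auto simp: t_def)
  \<comment> \<open>Jensen for fixed Q: the exponent acquires the factor |g|^2/p, of mean 1, and
    |Q'y|^2 < p by Bessel's inequality.\<close>
  have "(\<integral>\<^sup>+Q. ennreal (exp (sqn r (tmul p Q y) / 2)) \<partial>U)
     \<le> (\<integral>\<^sup>+Q. \<integral>\<^sup>+g. ennreal (exp (sqn p g / real p / 2 * sqn r (tmul p Q y))) \<partial>std_normal p \<partial>U)"
  proof (rule nn_integral_mono)
    fix Q assume "Q \<in> space U"
    then have Q: "Q \<in> stiefel p r" by (simp add: space_U)
    define b where "b = sqn r (tmul p Q y)"
    have b: "b < real p" using sqn_tmul_le[OF Q, of y] y by (simp add: b_def)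
    then have "b / real p < 1" using p by simp
    then have "(\<integral>\<^sup>+g. ennreal (exp (sqn p g / real p / 2 * b)) \<partial>std_normal p)
        = ennreal ((1 / sqrt (1 - b / real p)) ^ p)"
      using nn_integral_std_normal_exp_quad[of "b / real p" p "\<lambda>_. 0"]
      by (simp add: mult.commute)
    then show "ennreal (exp (sqn r (tmul p Q y) / 2))
        \<le> (\<integral>\<^sup>+g. ennreal (exp (sqn p g / real p / 2 * sqn r (tmul p Q y))) \<partial>std_normal p)"
      using exp_half_le_power[OF b] by (simp add: b_def ennreal_leI)
  qed
  also have "\<dots> = (\<integral>\<^sup>+g. \<integral>\<^sup>+Q. ennreal (exp (sqn p g / real p / 2 * sqn r (tmul p Q y))) \<partial>U \<partial>std_normal p)"
    by (subst Fubini_std_normal) auto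
  also have "\<dots> = (\<integral>\<^sup>+g. \<integral>\<^sup>+Q. ennreal (exp (t / 2 * sqn r (tmul p Q g))) \<partial>U \<partial>std_normal p)"
  proof (rule nn_integral_cong)
    fix g
    \<comment> \<open>The factor |g|/sqrt(p) is moved onto y. The result has the norm of sqrt(t) g,
      so by invariance the Gaussian vector takes the place of y.\<close>
    have "sqn p (\<lambda>j. sqrt (sqn p g / real p) * y j) = sqn p (\<lambda>j. sqrt t * g j)"
      using p t by (simp add: sqn_scale t_def)
    from nn_integral_U_eq_of_norm_eq[OF this, where g = "\<lambda>u. ennreal (exp (u / 2))"]
    have "(\<integral>\<^sup>+Q. ennreal (exp (sqn r (tmul p Q (\<lambda>j. sqrt (sqn p g / real p) * y j)) / 2)) \<partial>U)
        = (\<integral>\<^sup>+Q. ennreal (exp (sqn r (tmul p Q (\<lambda>j. sqrt t * g j)) / 2)) \<partial>U)"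
      by simp
    moreover have "sqn r (tmul p Q (\<lambda>j. s * x j)) = s\<^sup>2 * sqn r (tmul p Q x)" for Q s x
      by (simp add: sqn_def tmul_scale power_mult_distrib sum_distrib_left)
    ultimately show "(\<integral>\<^sup>+Q. ennreal (exp (sqn p g / real p / 2 * sqn r (tmul p Q y))) \<partial>U)
        = (\<integral>\<^sup>+Q. ennreal (exp (t / 2 * sqn r (tmul p Q g))) \<partial>U)"
      using p t by simp
  qed
  also have "\<dots> = (\<integral>\<^sup>+Q. \<integral>\<^sup>+g. ennreal (exp (t / 2 * sqn r (tmul p Q g))) \<partial>std_normal p \<partial>U)"
    by (subst Fubini_std_normal) auto
  also have "\<dots> = (\<integral>\<^sup>+Q. ennreal ((1 / sqrt (1 - t)) ^ r) \<partial>U)"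
  proof (intro nn_integral_cong)
    fix Q assume "Q \<in> space U"
    then have Q: "Q \<in> stiefel p r" by (simp add: space_U)
    show "(\<integral>\<^sup>+g. ennreal (exp (t / 2 * sqn r (tmul p Q g))) \<partial>std_normal p) = ennreal ((1 / sqrt (1 - t)) ^ r)"
      using nn_integral_std_normal_exp_proj[OF Q, of 0 t "\<lambda>_. 0"] t by simp
  qed
  also have "\<dots> = ennreal ((1 / sqrt (1 - t)) ^ r)" by (simp add: U.emeasure_space_1)
  finally show ?thesis by (simp add: t_def)
qed

text \<open>
  By convexity of \<open>exp\<close>, with weights proportional to the squared norms of the \<open>y i\<close>, this
  reduces to a single vector that carries the total squared norm.
\<close>

lemma nn_integral_U_exp_sum_le:
  fixes n :: nat
  assumes k: "0 \<le> k" and chi: "chi = (\<Sum>i<n. sqn p (y i))" and lt: "k * chi < real p"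
  shows "(\<integral>\<^sup>+Q. ennreal (exp (k / 2 * (\<Sum>i<n. sqn r (tmul p Q (y i))))) \<partial>U)
    \<le> ennreal ((1 / sqrt (1 - k * chi / real p)) ^ r)" (is "_ \<le> ennreal ?B")
\<comment> \<open>The weights need chi > 0. In the degenerate case Bessel's inequality bounds the
  exponent by k chi / 2 = 0.\<close>
proof (cases "k * chi = 0")
  case True
  have "(\<integral>\<^sup>+Q. ennreal (exp (k / 2 * (\<Sum>i<n. sqn r (tmul p Q (y i))))) \<partial>U) \<le> (\<integral>\<^sup>+Q. 1 \<partial>U)"
  proof (rule nn_integral_mono)
    fix Q assume "Q \<in> space U"
    then have "(\<Sum>i<n. sqn r (tmul p Q (y i))) \<le> chi"
      unfolding chi by (intro sum_mono sqn_tmul_le) (simp add: space_U)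
    then have "k / 2 * (\<Sum>i<n. sqn r (tmul p Q (y i))) \<le> k / 2 * chi"
      using k by (intro mult_left_mono) auto
    then show "ennreal (exp (k / 2 * (\<Sum>i<n. sqn r (tmul p Q (y i))))) \<le> 1"
      using True by (simp add: ennreal_le_1)
  qed
  moreover have "?B = 1" unfolding True by simp
  ultimately show ?thesis by (simp add: U.emeasure_space_1)
next
  case False
  have "chi \<ge> 0" unfolding chi by (intro sum_nonneg) simp
  then have pos: "k > 0" "chi > 0" using False k by auto
  \<comment> \<open>The vectors \<open>u i\<close> are scaled to the common squared norm k chi, with
    k|Q'(y i)|^2 = w i |Q'(u i)|^2. If w i = 0, then y i vanishes and k / w i = 0, so both sides are
    0.\<close>
  define w where "w i = sqn p (y i) / chi" for i
  define u where "u i = (\<lambda>j. sqrt (k / w i) * y i j)" for i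
  have w0: "0 \<le> w i" for i using pos by (simp add: w_def)
  have w1: "(\<Sum>i<n. w i) = 1" using pos by (simp add: w_def chi flip: sum_divide_distrib)
  then have n: "n \<noteq> 0" by (cases n) auto
  have su: "w i = 0 \<or> sqn p (u i) = k * chi" for i
    using pos by (auto simp: u_def sqn_scale w_def)
  have B0: "0 \<le> ?B" using lt pos \<open>chi > 0\<close> by (intro zero_le_power) (auto simp: divide_simps)
  have "(\<integral>\<^sup>+Q. ennreal (exp (k / 2 * (\<Sum>i<n. sqn r (tmul p Q (y i))))) \<partial>U)
     \<le> (\<integral>\<^sup>+Q. (\<Sum>i<n. ennreal (w i) * ennreal (exp (sqn r (tmul p Q (u i)) / 2))) \<partial>U)"
  proof (rule nn_integral_mono)
    fix Q assume "Q \<in> space U"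
    then have Q: "Q \<in> stiefel p r" by (simp add: space_U)
    have wi: "k / 2 * sqn r (tmul p Q (y i)) = w i * (sqn r (tmul p Q (u i)) / 2)" for i
    proof (cases "w i = 0")
      case True
      then have "sqn r (tmul p Q (y i)) = 0"
        using sqn_tmul_le[OF Q, of "y i"] pos sqn_nonneg[of r "tmul p Q (y i)"]
        by (simp add: w_def)
      then show ?thesis using True by simp
    next
      case False
      have "tmul p Q (u i) = (\<lambda>k'. sqrt (k / w i) * tmul p Q (y i) k')"
        by (auto simp: u_def tmul_scale)
      then have "sqn r (tmul p Q (u i)) = k / w i * sqn r (tmul p Q (y i))"
        using pos w0[of i] by (simp add: sqn_scale)
      then show ?thesis using False by simp
    qed
    have "exp (k / 2 * (\<Sum>i<n. sqn r (tmul p Q (y i)))) = exp (\<Sum>i<n. w i *\<^sub>R (sqn r (tmul p Q (u i)) / 2))"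
      by (simp only: sum_distrib_left wi real_scaleR_def)
    also have "\<dots> \<le> (\<Sum>i<n. w i * exp (sqn r (tmul p Q (u i)) / 2))"
      using n w0 w1 by (intro convex_on_sum[OF _ _ exp_convex]) auto
    finally show "ennreal (exp (k / 2 * (\<Sum>i<n. sqn r (tmul p Q (y i)))))
        \<le> (\<Sum>i<n. ennreal (w i) * ennreal (exp (sqn r (tmul p Q (u i)) / 2)))"
      using w0 by (simp add: ennreal_mult'[symmetric] sum_ennreal ennreal_leI)
  qed
  also have "\<dots> = (\<Sum>i<n. ennreal (w i) * (\<integral>\<^sup>+Q. ennreal (exp (sqn r (tmul p Q (u i)) / 2)) \<partial>U))"
    by (subst nn_integral_sum) (auto simp: nn_integral_cmult)
  also have "\<dots> \<le> (\<Sum>i<n. ennreal (w i) * ennreal ?B)"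
  proof (rule sum_mono)
    fix i
    show "ennreal (w i) * (\<integral>\<^sup>+Q. ennreal (exp (sqn r (tmul p Q (u i)) / 2)) \<partial>U) \<le> ennreal (w i) * ennreal ?B"
    proof (cases "w i = 0")
      case False
      then show ?thesis
        using su[of i] nn_integral_U_exp_le[of "u i"] lt by (intro mult_left_mono) auto
    qed simp
  qed
  also have "\<dots> = ennreal ?B"
    using w0 w1 B0 by (simp add: ennreal_mult'[symmetric] sum_ennreal flip: sum_distrib_right)
  finally show ?thesis .
qed

end

section \<open>The second moment of the likelihood ratio\<close>

text \<open>The squared Frobenius norm of the data, which for n > 0 is n times the trace of the
  sample covariance.\<close>

definition tot :: "nat \<Rightarrow> nat \<Rightarrow> (nat \<Rightarrow> nat \<Rightarrow> real) \<Rightarrow> real" where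
  "tot n p X = (\<Sum>i<n. sqn p (X i))"

lemma measurable_tot [measurable]: "tot n p \<in> borel_measurable (data_space n p)"
proof -
  have [measurable]: "(\<lambda>X. sqn p (X i)) \<in> borel_measurable (data_space n p)" if "i < n" for i
    using that by (intro measurable_compose[OF measurable_component_singleton[of i] measurable_sqn]) auto
  show ?thesis unfolding tot_def[abs_def] by (intro borel_measurable_sum) simp
qed

text \<open>Under the null law \<open>tot n p X\<close> is chi-square with np degrees of freedom;
  this is its moment generating function at c/2.\<close>

lemma nn_integral_null_law_exp_tot:
  assumes "c < 1"
  shows "(\<integral>\<^sup>+X. ennreal (exp (c / 2 * tot n p X)) \<partial>null_law n p) = ennreal ((1 / sqrt (1 - c)) ^ (p * n))"
proof -
  have "(\<integral>\<^sup>+X. ennreal (exp (c / 2 * tot n p X)) \<partial>null_law n p)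
      = (\<integral>\<^sup>+X. (\<Prod>i<n. ennreal (exp (c / 2 * sqn p (X i)))) \<partial>null_law n p)"
    by (intro nn_integral_cong) (simp add: prod_ennreal tot_def sum_distrib_left flip: exp_sum)
  also have "\<dots> = (\<integral>\<^sup>+x. ennreal (exp (c / 2 * sqn p x)) \<partial>std_normal p) ^ n"
    by (rule nn_integral_null_law_prod) measurable
  also have "(\<integral>\<^sup>+x. ennreal (exp (c / 2 * sqn p x)) \<partial>std_normal p) = ennreal ((1 / sqrt (1 - c)) ^ p)"
    using nn_integral_std_normal_exp_quad[OF assms, of p "\<lambda>_. 0"] by simp
  finally show ?thesis using assms by (simp add: ennreal_power power_mult)
qed

text \<open>Only the factor with \<open>Q\<close> is linearised, by a Gaussian z. Integrating x out
  then leaves \<open>Q'\<close> only in the norm of its transpose applied to Qz. The coefficient is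
  d/(1-d) from \<open>nn_integral_std_normal_exp_proj\<close> times d from the scaling sqrt(d) of
  Qz.\<close>

lemma nn_integral_lik1_lik1:
  assumes Q: "Q \<in> stiefel p r" and Q': "Q' \<in> stiefel p r" and d: "0 \<le> d" "d < 1"
  shows "(\<integral>\<^sup>+x. ennreal (lik1 p r d Q x) * ennreal (lik1 p r d Q' x) \<partial>std_normal p)
    = (\<integral>\<^sup>+z. ennreal (sqrt (1 - d) ^ r * exp (d / 2 * sqn r z
        + d\<^sup>2 / (1 - d) / 2 * sqn r (tmul p Q' (mul r Q z)))) \<partial>std_normal r)"
proof -
  define s where "s = sqrt (1 - d) ^ r"
  have s: "s > 0" using d by (simp add: s_def)
  define f where "f x z = ennreal (s\<^sup>2 * exp ((\<Sum>j<p. sqrt d * mul r Q z j * x j) + d / 2 * sqn r (tmul p Q' x)))" for x z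
  interpret P: pair_sigma_finite "std_normal r" "std_normal p"
    by (simp add: pair_sigma_finite_def sigma_finite_std_normal)
  have [measurable]: "(\<lambda>(x, z). f x z) \<in> borel_measurable (euclid_space p \<Otimes>\<^sub>M euclid_space r)"
    unfolding f_def mul_def sqn_def tmul_def by measurable
  note lin = sum_scaled_mul_eq_sum_scaled_tmul[where s = "sqrt d"]
  have "ennreal (lik1 p r d Q x) * ennreal (lik1 p r d Q' x) = (\<integral>\<^sup>+z. f x z \<partial>std_normal r)" for x
  proof -
    have "(\<integral>\<^sup>+z. f x z \<partial>std_normal r)
        = (\<integral>\<^sup>+z. ennreal (s\<^sup>2 * exp (d / 2 * sqn r (tmul p Q' x)))
            * ennreal (exp (0 / 2 * sqn r z + (\<Sum>k<r. sqrt d * tmul p Q x k * z k))) \<partial>std_normal r)"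
      unfolding f_def lin by (intro nn_integral_cong) (simp add: ennreal_mult'[symmetric] exp_add mult_ac)
    also have "\<dots> = ennreal (s\<^sup>2 * exp (d / 2 * sqn r (tmul p Q' x))) * ennreal (exp (d / 2 * sqn r (tmul p Q x)))"
      using nn_integral_std_normal_exp_quad[of 0 r "\<lambda>k. sqrt d * tmul p Q x k"] d
      by (subst nn_integral_cmult) (auto simp: sqn_scale)
    also have "\<dots> = ennreal (lik1 p r d Q x) * ennreal (lik1 p r d Q' x)"
      using s by (simp add: lik1_def ennreal_mult'[symmetric] power2_eq_square mult_ac flip: s_def)
    finally show ?thesis by simp
  qed
  then have "(\<integral>\<^sup>+x. ennreal (lik1 p r d Q x) * ennreal (lik1 p r d Q' x) \<partial>std_normal p)
      = (\<integral>\<^sup>+x. \<integral>\<^sup>+z. f x z \<partial>std_normal r \<partial>std_normal p)" by simp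
  also have "\<dots> = (\<integral>\<^sup>+z. \<integral>\<^sup>+x. f x z \<partial>std_normal p \<partial>std_normal r)"
    by (subst P.Fubini') (auto simp: case_prod_beta)
  also have "\<dots> = (\<integral>\<^sup>+z. ennreal (s * exp (d / 2 * sqn r z
        + d\<^sup>2 / (1 - d) / 2 * sqn r (tmul p Q' (mul r Q z)))) \<partial>std_normal r)"
  proof (rule nn_integral_cong)
    fix z
    define E where "E = exp (d / 2 * sqn r z + d\<^sup>2 / (1 - d) / 2 * sqn r (tmul p Q' (mul r Q z)))"
    have t: "sqn r (tmul p Q' (\<lambda>j. sqrt d * mul r Q z j)) = d * sqn r (tmul p Q' (mul r Q z))"
      using d by (simp add: tmul_scale sqn_def power_mult_distrib sum_distrib_left)
    have "(\<integral>\<^sup>+x. f x z \<partial>std_normal p)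
      = ennreal (s\<^sup>2) * (\<integral>\<^sup>+x. ennreal (exp (0 / 2 * sqn p x + (\<Sum>j<p. sqrt d * mul r Q z j * x j)
          + d / 2 * sqn r (tmul p Q' x))) \<partial>std_normal p)"
      unfolding f_def by (subst nn_integral_cmult[symmetric]) (auto simp: ennreal_mult' sqn_def)
    also have "(\<integral>\<^sup>+x. ennreal (exp (0 / 2 * sqn p x + (\<Sum>j<p. sqrt d * mul r Q z j * x j)
          + d / 2 * sqn r (tmul p Q' x))) \<partial>std_normal p)
      = ennreal ((1 / sqrt (1 - d)) ^ r * E)"
      using nn_integral_std_normal_exp_proj[OF Q', of 0 d "\<lambda>j. sqrt d * mul r Q z j"] d
      by (simp add: sqn_scale sqn_mul[OF Q] t E_def power2_eq_square mult.assoc)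
    also have "ennreal (s\<^sup>2) * ennreal ((1 / sqrt (1 - d)) ^ r * E) = ennreal (s * E)"
      using s by (simp add: ennreal_mult'[symmetric] power_one_over power2_eq_square flip: s_def)
    finally show "(\<integral>\<^sup>+x. f x z \<partial>std_normal p) = ennreal (s * exp (d / 2 * sqn r z
        + d\<^sup>2 / (1 - d) / 2 * sqn r (tmul p Q' (mul r Q z))))" by (simp add: E_def)
  qed
  finally show ?thesis by (simp add: s_def)
qed

lemma nn_integral_lik_lik:
  assumes Q: "Q \<in> stiefel p r" and Q': "Q' \<in> stiefel p r" and d: "0 \<le> d" "d < 1"
  shows "(\<integral>\<^sup>+X. ennreal (lik n p r d Q X) * ennreal (lik n p r d Q' X) \<partial>null_law n p)
    = (\<integral>\<^sup>+Z. ennreal (sqrt (1 - d) ^ (r * n) * exp (d / 2 * tot n r Z)) * ennreal (exp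
        (d\<^sup>2 / (1 - d) / 2 * (\<Sum>i<n. sqn r (tmul p Q' (mul r Q (Z i)))))) \<partial>null_law n r)"
proof -
  let ?g = "\<lambda>z. ennreal (sqrt (1 - d) ^ r * exp (d / 2 * sqn r z
        + d\<^sup>2 / (1 - d) / 2 * sqn r (tmul p Q' (mul r Q z))))"
  have "(\<integral>\<^sup>+X. ennreal (lik n p r d Q X) * ennreal (lik n p r d Q' X) \<partial>null_law n p)
     = (\<integral>\<^sup>+X. (\<Prod>i<n. ennreal (lik1 p r d Q (X i)) * ennreal (lik1 p r d Q' (X i))) \<partial>null_law n p)"
    using d by (simp add: lik_def prod.distrib prod_ennreal lik1_nonneg)
  also have "\<dots> = (\<integral>\<^sup>+x. ennreal (lik1 p r d Q x) * ennreal (lik1 p r d Q' x) \<partial>std_normal p) ^ n"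
    by (rule nn_integral_null_law_prod) measurable
  also have "\<dots> = (\<integral>\<^sup>+z. ?g z \<partial>std_normal r) ^ n"
    by (simp add: nn_integral_lik1_lik1[OF assms])
  also have "\<dots> = (\<integral>\<^sup>+Z. (\<Prod>i<n. ?g (Z i)) \<partial>null_law n r)"
    by (rule nn_integral_null_law_prod[symmetric]) (unfold tmul_def mul_def sqn_def, measurable)
  also have "\<dots> = (\<integral>\<^sup>+Z. ennreal (sqrt (1 - d) ^ (r * n) * exp (d / 2 * tot n r Z)) * ennreal (exp
        (d\<^sup>2 / (1 - d) / 2 * (\<Sum>i<n. sqn r (tmul p Q' (mul r Q (Z i)))))) \<partial>null_law n r)"
    using d by (intro nn_integral_cong)
      (simp add: prod_ennreal prod.distrib power_mult tot_def ennreal_mult'[symmetric] sum.distrib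
        sum_distrib_left exp_add mult.assoc flip: exp_sum)
  finally show ?thesis .
qed

context uniform_prior
begin

text \<open>The square is a double average over independent \<open>Q\<close> and \<open>Q'\<close>.
  Tonelli places the average over \<open>Q'\<close> innermost, where \<open>Q\<close> and the
  Gaussian \<open>Z\<close> are fixed and the bounds from invariance apply.\<close>

lemma nn_integral_mix_lik_sq:
  assumes d: "0 \<le> d" "d < 1"
  shows "(\<integral>\<^sup>+X. (mix_lik n d X)\<^sup>2 \<partial>null_law n p)
    = (\<integral>\<^sup>+Q. \<integral>\<^sup>+Z. ennreal (sqrt (1 - d) ^ (r * n) * exp (d / 2 * tot n r Z)) *
        (\<integral>\<^sup>+Q'. ennreal (exp (d\<^sup>2 / (1 - d) / 2 * (\<Sum>i<n. sqn r (tmul p Q' (mul r Q (Z i)))))) \<partial>U)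
        \<partial>null_law n r \<partial>U)"
proof -
  have ml: "(\<lambda>Q. lik n p r d Q X) \<in> borel_measurable U" if "X \<in> space (null_law n p)" for X
    using measurable_Pair1[OF measurable_lik[of n d], of X] that by simp
  have "(\<integral>\<^sup>+X. (mix_lik n d X)\<^sup>2 \<partial>null_law n p)
      = (\<integral>\<^sup>+X. \<integral>\<^sup>+Q. ennreal (lik n p r d Q X) * mix_lik n d X \<partial>U \<partial>null_law n p)"
    using ml by (intro nn_integral_cong) (simp add: nn_integral_multc power2_eq_square, simp add: mix_lik_def)
  also have "\<dots> = (\<integral>\<^sup>+Q. \<integral>\<^sup>+X. ennreal (lik n p r d Q X) * mix_lik n d X \<partial>null_law n p \<partial>U)"
    by (rule Fubini_null_law) measurable
  also have "\<dots> = (\<integral>\<^sup>+Q. \<integral>\<^sup>+Z. ennreal (sqrt (1 - d) ^ (r * n) * exp (d / 2 * tot n r Z)) *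
        (\<integral>\<^sup>+Q'. ennreal (exp (d\<^sup>2 / (1 - d) / 2 * (\<Sum>i<n. sqn r (tmul p Q' (mul r Q (Z i)))))) \<partial>U)
        \<partial>null_law n r \<partial>U)"
  proof (rule nn_integral_cong)
    fix Q assume "Q \<in> space U"
    then have Q: "Q \<in> stiefel p r" by (simp add: space_U)
    have Zi: "(\<lambda>\<omega>. snd \<omega> i k) \<in> borel_measurable (U \<Otimes>\<^sub>M data_space n r)" if "i < n" "k < r" for i k
      using that by (intro measurable_compose[OF measurable_compose[OF measurable_snd
              measurable_component_singleton[of i]] measurable_component_singleton[of k]]) auto
    have [measurable]: "(\<lambda>\<omega>. sqn r (tmul p (fst \<omega>) (mul r Q (snd \<omega> i)))) \<in> borel_measurable (U \<Otimes>\<^sub>M data_space n r)"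
      if "i < n" for i
      using Zi[OF that] unfolding mul_def
      by (intro measurable_sqn_tmul measurable_fst borel_measurable_sum borel_measurable_times) auto
    have [measurable]: "(\<lambda>\<omega>. \<Sum>i<n. sqn r (tmul p (fst \<omega>) (mul r Q (snd \<omega> i)))) \<in> borel_measurable (U \<Otimes>\<^sub>M data_space n r)"
      by (intro borel_measurable_sum) simp
    have mQ: "lik n p r d Q \<in> borel_measurable (data_space n p)" using Q by (rule measurable_lik_data)
    have "(\<integral>\<^sup>+X. ennreal (lik n p r d Q X) * mix_lik n d X \<partial>null_law n p)
        = (\<integral>\<^sup>+X. \<integral>\<^sup>+Q'. ennreal (lik n p r d Q X) * ennreal (lik n p r d Q' X) \<partial>U \<partial>null_law n p)"
      using ml by (intro nn_integral_cong) (simp add: nn_integral_cmult, simp add: mix_lik_def)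
    also have "\<dots> = (\<integral>\<^sup>+Q'. \<integral>\<^sup>+X. ennreal (lik n p r d Q X) * ennreal (lik n p r d Q' X) \<partial>null_law n p \<partial>U)"
    proof (rule Fubini_null_law)
      have [measurable]: "(\<lambda>\<omega>. lik n p r d Q (snd \<omega>)) \<in> borel_measurable (U \<Otimes>\<^sub>M data_space n p)"
        by (rule measurable_compose[OF measurable_snd mQ])
      have [measurable]: "(\<lambda>\<omega>. lik n p r d (fst \<omega>) (snd \<omega>)) \<in> borel_measurable (U \<Otimes>\<^sub>M data_space n p)"
        using measurable_lik[of n d] by (simp add: case_prod_beta)
      show "(\<lambda>(Q', X). ennreal (lik n p r d Q X) * ennreal (lik n p r d Q' X))
          \<in> borel_measurable (U \<Otimes>\<^sub>M data_space n p)"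
        unfolding case_prod_beta by measurable
    qed
    also have "\<dots> = (\<integral>\<^sup>+Q'. \<integral>\<^sup>+Z. ennreal (sqrt (1 - d) ^ (r * n) * exp (d / 2 * tot n r Z)) * ennreal (exp
        (d\<^sup>2 / (1 - d) / 2 * (\<Sum>i<n. sqn r (tmul p Q' (mul r Q (Z i)))))) \<partial>null_law n r \<partial>U)"
      by (rule nn_integral_cong) (simp add: nn_integral_lik_lik[OF Q _ d] space_U)
    also have "\<dots> = (\<integral>\<^sup>+Z. \<integral>\<^sup>+Q'. ennreal (sqrt (1 - d) ^ (r * n) * exp (d / 2 * tot n r Z)) * ennreal (exp
        (d\<^sup>2 / (1 - d) / 2 * (\<Sum>i<n. sqn r (tmul p Q' (mul r Q (Z i)))))) \<partial>U \<partial>null_law n r)"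
      by (rule Fubini_null_law[symmetric]) (simp add: case_prod_beta)
    also have "\<dots> = (\<integral>\<^sup>+Z. ennreal (sqrt (1 - d) ^ (r * n) * exp (d / 2 * tot n r Z)) *
        (\<integral>\<^sup>+Q'. ennreal (exp (d\<^sup>2 / (1 - d) / 2 * (\<Sum>i<n. sqn r (tmul p Q' (mul r Q (Z i)))))) \<partial>U)
        \<partial>null_law n r)"
      by (rule nn_integral_cong, rule nn_integral_cmult) measurable
    finally show "(\<integral>\<^sup>+X. ennreal (lik n p r d Q X) * mix_lik n d X \<partial>null_law n p) = \<dots>" .
  qed
  finally show ?thesis .
qed

text \<open>
  The bound of \<open>nn_integral_U_exp_sum_le\<close> is used when \<open>tot n r Z\<close> is at most four times its
  mean \<open>n * r\<close> under the null law; otherwise \<open>|Q'y| \<le> |y|\<close> suffices, since that event is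
  exponentially unlikely.
\<close>

lemma nn_integral_mix_lik_sq_le:
  assumes d: "0 \<le> d" "d < 1" "d + d\<^sup>2 / (1 - d) \<le> 1 / 8"
    and lt: "4 * (d\<^sup>2 / (1 - d)) * real (r * n) < real p"
  shows "(\<integral>\<^sup>+X. (mix_lik n d X)\<^sup>2 \<partial>null_law n p)
    \<le> ennreal ((1 / sqrt (1 - 4 * (d\<^sup>2 / (1 - d)) * real (r * n) / real p)) ^ r + exp (- real (r * n) / 2))"
proof -
  define k where "k = d\<^sup>2 / (1 - d)"
  define N where "N = real (r * n)"
  define B where "B = (1 / sqrt (1 - 4 * k * N / real p)) ^ r"
  note d1 = d(2)
  have k: "0 \<le> k" using d1 by (simp add: k_def)
  have dk: "d + k \<le> 1 / 8" using d by (simp add: k_def)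
  have lt: "4 * k * N < real p" using lt by (simp add: k_def N_def)
  have p: "real p > 0" using lt k by (smt (verit) N_def mult_nonneg_nonneg of_nat_0_le_iff)
  have B0: "0 \<le> B" unfolding B_def using lt p by (intro zero_le_power) (simp add: field_simps)
  have inner: "(\<integral>\<^sup>+Q'. ennreal (exp (k / 2 * (\<Sum>i<n. sqn r (tmul p Q' (mul r Q (Z i)))))) \<partial>U)
      \<le> ennreal (B + exp (- N) * exp ((k + 1 / 2) / 2 * tot n r Z))"
    if Q: "Q \<in> stiefel p r" for Q Z
  proof (cases "tot n r Z \<le> 4 * N")
    case True
    have chi: "tot n r Z = (\<Sum>i<n. sqn p (mul r Q (Z i)))" by (simp add: tot_def sqn_mul[OF Q])
    have le: "k * tot n r Z \<le> 4 * k * N" using mult_left_mono[OF True k] by simp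
    then have "(\<integral>\<^sup>+Q'. ennreal (exp (k / 2 * (\<Sum>i<n. sqn r (tmul p Q' (mul r Q (Z i)))))) \<partial>U)
        \<le> ennreal ((1 / sqrt (1 - k * tot n r Z / real p)) ^ r)"
      using lt by (intro nn_integral_U_exp_sum_le[OF k chi]) simp
    also have "\<dots> \<le> ennreal B"
    proof -
      have "k * tot n r Z / real p \<le> 4 * k * N / real p" using le by (intro divide_right_mono) auto
      moreover have "4 * k * N / real p < 1" using lt p by simp
      ultimately show ?thesis
        unfolding B_def by (intro ennreal_leI power_mono divide_left_mono) (auto intro!: mult_pos_pos)
    qed
    also have "\<dots> \<le> ennreal (B + exp (- N) * exp ((k + 1 / 2) / 2 * tot n r Z))"
      by (intro ennreal_leI) simp
    finally show ?thesis .
  next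
    case False
    have "(\<integral>\<^sup>+Q'. ennreal (exp (k / 2 * (\<Sum>i<n. sqn r (tmul p Q' (mul r Q (Z i)))))) \<partial>U)
        \<le> (\<integral>\<^sup>+Q'. ennreal (exp (k / 2 * tot n r Z)) \<partial>U)"
    proof (rule nn_integral_mono)
      fix Q' assume "Q' \<in> space U"
      then have "(\<Sum>i<n. sqn r (tmul p Q' (mul r Q (Z i)))) \<le> (\<Sum>i<n. sqn p (mul r Q (Z i)))"
        by (intro sum_mono sqn_tmul_le) (simp add: space_U)
      also have "\<dots> = tot n r Z" by (simp add: tot_def sqn_mul[OF Q])
      finally show "ennreal (exp (k / 2 * (\<Sum>i<n. sqn r (tmul p Q' (mul r Q (Z i))))))
          \<le> ennreal (exp (k / 2 * tot n r Z))"
        using k by (intro ennreal_leI) (simp add: mult_left_mono)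
    qed
    also have "\<dots> = ennreal (exp (k / 2 * tot n r Z))" by (simp add: U.emeasure_space_1)
    also have "\<dots> \<le> ennreal (B + exp (- N) * exp ((k + 1 / 2) / 2 * tot n r Z))"
    proof (intro ennreal_leI)
      \<comment> \<open>Here \<open>tot n r Z\<close> / 4 > N, so raising the coefficient by 1/2
        pays for the factor exp(-N).\<close>
      have "k / 2 * tot n r Z \<le> - N + (k + 1 / 2) / 2 * tot n r Z"
        using False by (simp add: algebra_simps)
      then have "exp (k / 2 * tot n r Z) \<le> exp (- N + (k + 1 / 2) / 2 * tot n r Z)" by simp
      also have "\<dots> = exp (- N) * exp ((k + 1 / 2) / 2 * tot n r Z)" by (rule exp_add)
      finally show "exp (k / 2 * tot n r Z) \<le> B + exp (- N) * exp ((k + 1 / 2) / 2 * tot n r Z)"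
        using B0 by linarith
    qed
    finally show ?thesis .
  qed
  define s where "s = sqrt (1 - d) ^ (r * n)"
  have s: "0 < s" "s \<le> 1" using d d1 by (auto simp: s_def intro!: power_le_one)
  \<comment> \<open>The d of the outer weight is added to k + 1/2; the smallness assumption keeps c
    at most 5/8, so the exponential moment is finite.\<close>
  define c where "c = d + k + 1 / 2"
  have c: "c < 1" "c \<le> 5 / 8" using dk by (auto simp: c_def)
  have "(\<integral>\<^sup>+X. (mix_lik n d X)\<^sup>2 \<partial>null_law n p) \<le> (\<integral>\<^sup>+Q. ennreal (B + exp (- N / 2)) \<partial>U)"
    unfolding nn_integral_mix_lik_sq[OF d(1) d1] k_def[symmetric] s_def[symmetric]
  proof (rule nn_integral_mono)
    fix Q assume "Q \<in> space U"
    then have Q: "Q \<in> stiefel p r" by (simp add: space_U)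
    have "(\<integral>\<^sup>+Z. ennreal (s * exp (d / 2 * tot n r Z)) *
        (\<integral>\<^sup>+Q'. ennreal (exp (k / 2 * (\<Sum>i<n. sqn r (tmul p Q' (mul r Q (Z i)))))) \<partial>U) \<partial>null_law n r)
      \<le> (\<integral>\<^sup>+Z. ennreal (s * exp (d / 2 * tot n r Z)) *
          ennreal (B + exp (- N) * exp ((k + 1 / 2) / 2 * tot n r Z)) \<partial>null_law n r)"
      by (intro nn_integral_mono mult_left_mono inner Q) auto
    also have "\<dots> = (\<integral>\<^sup>+Z. ennreal (s * B) * ennreal (exp (d / 2 * tot n r Z))
          + ennreal (s * exp (- N)) * ennreal (exp (c / 2 * tot n r Z)) \<partial>null_law n r)"
    proof (rule nn_integral_cong)
      fix Z
      have "exp (c / 2 * tot n r Z) = exp (d / 2 * tot n r Z) * exp ((k + 1 / 2) / 2 * tot n r Z)"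
        unfolding c_def by (simp add: add_divide_distrib distrib_right flip: exp_add)
      then show "ennreal (s * exp (d / 2 * tot n r Z)) * ennreal (B + exp (- N) * exp ((k + 1 / 2) / 2 * tot n r Z))
        = ennreal (s * B) * ennreal (exp (d / 2 * tot n r Z))
          + ennreal (s * exp (- N)) * ennreal (exp (c / 2 * tot n r Z))"
        using s B0 by (simp add: ennreal_mult'[symmetric] ennreal_plus[symmetric] algebra_simps del: ennreal_plus)
    qed
    also have "\<dots> = ennreal (s * B) * ennreal ((1 / sqrt (1 - d)) ^ (r * n))
          + ennreal (s * exp (- N)) * ennreal ((1 / sqrt (1 - c)) ^ (r * n))"
      using nn_integral_null_law_exp_tot[OF d1, of n r] nn_integral_null_law_exp_tot[OF c(1), of n r]
      by (simp add: nn_integral_add nn_integral_cmult)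
    \<comment> \<open>The prefactor s cancels (1 - d)^{-rn/2}, so the first summand is exactly
      B.\<close>
    also have "\<dots> = ennreal (B + s * exp (- N) * (1 / sqrt (1 - c)) ^ (r * n))"
      using s B0 d1 c by (simp add: ennreal_mult'[symmetric] ennreal_plus[symmetric] power_one_over del: ennreal_plus flip: s_def)
    also have "\<dots> \<le> ennreal (B + exp (- N / 2))"
    proof (intro ennreal_leI add_left_mono)
      \<comment> \<open>As 1 - c >= 3/8 >= exp(-1), the moment is at most exp(N/2), which uses up
        only half of the exponent in exp(-N).\<close>
      have "3 / 8 \<le> 1 - c" using c by simp
      moreover have "exp (-1) \<le> (3 / 8 :: real)"
      proof -
        have "8 / 3 \<le> exp (1 :: real)"
          using e_approx_32 by (simp add: abs_if split: if_split_asm)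
        then show ?thesis by (simp add: exp_minus field_simps)
      qed
      ultimately have "exp (-1) \<le> 1 - c" by simp
      then have "sqrt (exp (-1)) \<le> sqrt (1 - c)" by simp
      moreover have "sqrt (exp (-1)) = exp (- (1 / 2))"
        by (rule real_sqrt_unique) (simp_all flip: exp_of_nat_mult)
      ultimately have "1 / sqrt (1 - c) \<le> 1 / exp (- (1 / 2))"
        using c by (intro divide_left_mono) auto
      also have "\<dots> = exp (1 / 2)" by (simp add: exp_minus inverse_eq_divide)
      finally have "(1 / sqrt (1 - c)) ^ (r * n) \<le> exp (1 / 2) ^ (r * n)"
        using c by (intro power_mono) auto
      also have "\<dots> = exp (N / 2)" by (simp add: N_def flip: exp_of_nat_mult)
      finally have "s * exp (- N) * (1 / sqrt (1 - c)) ^ (r * n) \<le> 1 * exp (- N) * exp (N / 2)"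
        using s c by (intro mult_mono) auto
      also have "\<dots> = exp (- N / 2)" by (simp flip: exp_add)
      finally show "s * exp (- N) * (1 / sqrt (1 - c)) ^ (r * n) \<le> exp (- N / 2)" .
    qed
    finally show "(\<integral>\<^sup>+Z. ennreal (s * exp (d / 2 * tot n r Z)) *
        (\<integral>\<^sup>+Q'. ennreal (exp (k / 2 * (\<Sum>i<n. sqn r (tmul p Q' (mul r Q (Z i)))))) \<partial>U) \<partial>null_law n r)
      \<le> ennreal (B + exp (- N / 2))" .
  qed
  also have "\<dots> = ennreal (B + exp (- N / 2))" by (simp add: U.emeasure_space_1)
  finally show ?thesis by (simp add: B_def N_def k_def)
qed

end

section \<open>The trace test\<close>

lemma integral_le_of_nn_integral_le:
  fixes f :: "'a \<Rightarrow> real"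
  assumes "f \<in> borel_measurable M" "\<And>x. x \<in> space M \<Longrightarrow> 0 \<le> f x"
    and "(\<integral>\<^sup>+x. ennreal (f x) \<partial>M) \<le> ennreal C" "0 \<le> C"
  shows "(\<integral>x. f x \<partial>M) \<le> C"
  using assms by (subst integral_eq_nn_integral) (auto intro: enn2real_leI AE_I2)

lemma trace_test_eq:
  assumes "n > 0"
  shows "trace_test q n p X
    = (if sqrt (2 * q * ln n) \<le> 1 / sqrt (2 * real n * real p) * (tot n p X - real n * real p) then 1 else 0)"
proof -
  have "mat_trace (sample_cov n p X) = (\<Sum>j<p. 1 / real n * (\<Sum>i<n. X i j * X i j))"
    by (simp add: mat_trace_def sample_cov_def)
  also have "\<dots> = 1 / real n * (\<Sum>j<p. \<Sum>i<n. X i j * X i j)"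
    by (simp only: sum_distrib_left)
  also have "(\<Sum>j<p. \<Sum>i<n. X i j * X i j) = tot n p X"
    unfolding tot_def sqn_def power2_eq_square by (rule sum.swap)
  finally have "real n * mat_trace (sample_cov n p X) = tot n p X" using assms by simp
  moreover have "(2 * real n * real p) powr (- 1 / 2) = 1 / sqrt (2 * real n * real p)"
    by (simp add: powr_minus_divide powr_half_sqrt)
  ultimately show ?thesis by (simp add: trace_test_def indicator_def)
qed

lemma measurable_trace_test:
  assumes "n > 0"
  shows "trace_test q n p \<in> borel_measurable (data_space n p)"
  unfolding trace_test_eq[OF assms, abs_def] by measurable

text \<open>From ln(1 - u) >= -u - 2u^2 at u = 2s <= 1/2, halved and exponentiated.\<close>

lemma inverse_sqrt_one_minus_le:
  fixes s :: real
  assumes "0 \<le> s" "s \<le> 1 / 4"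
  shows "1 / sqrt (1 - 2 * s) \<le> exp (s + 4 * s\<^sup>2)"
proof -
  have "- (2 * s) - 2 * (2 * s)\<^sup>2 \<le> ln (1 - 2 * s)"
    using assms by (intro ln_one_minus_pos_lower_bound) auto
  then have "exp (- (2 * s) - 2 * (2 * s)\<^sup>2) \<le> 1 - 2 * s"
    using assms by (simp add: ln_ge_iff)
  then have "exp (- (s + 4 * s\<^sup>2)) \<le> sqrt (1 - 2 * s)"
    by (intro real_le_rsqrt) (simp add: power2_eq_square flip: exp_add)
  then have "1 / sqrt (1 - 2 * s) \<le> 1 / exp (- (s + 4 * s\<^sup>2))"
    using assms by (intro divide_left_mono) auto
  also have "\<dots> = exp (s + 4 * s\<^sup>2)" by (simp add: exp_minus inverse_eq_divide del: minus_add_distrib)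
  finally show ?thesis .
qed

text \<open>Chernoff's bound with exponent s = (2np)^{-1/2}, the standardising factor itself: the
  linear terms cancel and the quadratic ones add up to 4Ns^2 = 2. The condition on np gives s <=
  1/4.\<close>

lemma test_level_trace_test_le:
  assumes np: "8 \<le> n * p"
  shows "test_level n p (trace_test q n p) \<le> exp (2 - sqrt (2 * q * ln n))"
proof -
  define a N s where "a = sqrt (2 * q * ln n)" and "N = real n * real p" and "s = 1 / sqrt (2 * N)"
  have n: "n > 0" using np by (cases n) auto
  have N: "N \<ge> 8" using np unfolding N_def by (metis of_nat_le_iff of_nat_mult of_nat_numeral)
  have "sqrt (2 * N) \<ge> 4" using N by (intro real_le_rsqrt) simp
  then have s4: "s \<le> 1 / 4" using N by (simp add: s_def field_simps)
  have s0: "s > 0" using N by (simp add: s_def)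
  have s2: "N * (4 * s\<^sup>2) = 2" using N by (simp add: s_def power_divide)
  have "(\<integral>\<^sup>+X. ennreal (trace_test q n p X) \<partial>null_law n p)
      \<le> (\<integral>\<^sup>+X. ennreal (exp (- a - s * N)) * ennreal (exp (2 * s / 2 * tot n p X)) \<partial>null_law n p)"
  proof (rule nn_integral_mono)
    fix X
    have T: "1 / sqrt (2 * real n * real p) * (tot n p X - real n * real p) = s * tot n p X - s * N"
      unfolding s_def N_def by (simp only: right_diff_distrib mult.assoc)
    have "trace_test q n p X \<le> exp (- a - s * N + 2 * s / 2 * tot n p X)"
      unfolding trace_test_eq[OF n] a_def[symmetric] T
    proof (cases "a \<le> s * tot n p X - s * N")
      case True
      then have "0 \<le> - a - s * N + 2 * s / 2 * tot n p X" by linarith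
      then show "(if a \<le> s * tot n p X - s * N then 1 else 0) \<le> exp (- a - s * N + 2 * s / 2 * tot n p X)"
        using True by (simp only: if_True one_le_exp_iff)
    qed (simp only: if_False exp_ge_zero)
    then show "ennreal (trace_test q n p X) \<le> ennreal (exp (- a - s * N)) * ennreal (exp (2 * s / 2 * tot n p X))"
      unfolding ennreal_exp_add[symmetric] by (rule ennreal_leI)
  qed
  also have "\<dots> = ennreal (exp (- a - s * N)) * ennreal ((1 / sqrt (1 - 2 * s)) ^ (p * n))"
    using nn_integral_null_law_exp_tot[of "2 * s" n p] s4 by (subst nn_integral_cmult) auto
  also have "\<dots> \<le> ennreal (exp (- a - s * N)) * ennreal (exp (s * N + 2))"
  proof (intro mult_left_mono ennreal_leI)
    have "(1 / sqrt (1 - 2 * s)) ^ (p * n) \<le> exp (s + 4 * s\<^sup>2) ^ (p * n)"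
      using s0 s4 by (intro power_mono inverse_sqrt_one_minus_le) auto
    also have "\<dots> = exp (N * (s + 4 * s\<^sup>2))" by (simp only: exp_of_nat_mult[symmetric] N_def of_nat_mult mult.commute[of "real p"])
    also have "N * (s + 4 * s\<^sup>2) = s * N + 2" using s2 by (simp only: distrib_left mult.commute[of s])
    finally show "(1 / sqrt (1 - 2 * s)) ^ (p * n) \<le> exp (s * N + 2)" .
  qed simp
  also have "\<dots> = ennreal (exp (2 - a))" unfolding ennreal_exp_add[symmetric] by simp
  finally have le: "(\<integral>\<^sup>+X. ennreal (trace_test q n p X) \<partial>null_law n p) \<le> ennreal (exp (2 - a))" .
  have m: "trace_test q n p \<in> borel_measurable (null_law n p)"
    using measurable_trace_test[OF n] by (simp only: measurable_cong_sets[OF sets_null_law refl])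
  have "0 \<le> trace_test q n p X" for X by (simp add: trace_test_def)
  from integral_le_of_nn_integral_le[OF m this le exp_ge_zero] show ?thesis
    by (simp only: test_level_def rejection_prob_def a_def)
qed

text \<open>The factor that each column of Q contributes to the Laplace transform of |x|^2 at s.
  After squaring, it suffices that exp(ds/2) <= 1 + ds and (1-d)(1+ds) <= 1 - d + ds <= 1 -
  d/(1+2s).\<close>

lemma lik1_ratio_le:
  fixes d s :: real
  assumes d: "0 \<le> d" "d \<le> 1 / 2" and s: "0 \<le> s" "s \<le> 1 / 4"
  shows "sqrt (1 - d) * (1 / sqrt (1 - d / (1 + 2 * s))) \<le> exp (- (d * s / 4))"
proof -
  have "d * s \<le> 1 / 2 * (1 / 4)" using d s by (intro mult_mono) auto
  then have ds: "0 \<le> d * s" "d * s \<le> 1" using d s by auto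
  have "exp (d * s / 2) \<le> 1 + d * s / 2 + (d * s / 2)\<^sup>2" using ds by (intro exp_bound) auto
  also have "\<dots> \<le> 1 + d * s"
    using ds mult_left_mono[OF ds(2) ds(1)] by (simp add: power2_eq_square)
  finally have e: "exp (d * s / 2) \<le> 1 + d * s" .
  have "(1 - d) * exp (d * s / 2) \<le> (1 - d) * (1 + d * s)" using e d by (intro mult_left_mono) auto
  also have "\<dots> \<le> 1 - d / (1 + 2 * s)"
  proof -
    have "(1 - d) * (d * s) \<le> d * (2 * s / (1 + 2 * s))"
    proof -
      have "s * (1 + 2 * s) \<le> s * 2" using s by (intro mult_left_mono) auto
      then have "s \<le> 2 * s / (1 + 2 * s)" using s by (simp add: field_simps)
      then have "d * s \<le> d * (2 * s / (1 + 2 * s))" using d by (intro mult_left_mono) auto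
      moreover have "(1 - d) * (d * s) \<le> 1 * (d * s)" using d ds by (intro mult_right_mono) auto
      ultimately show ?thesis by simp
    qed
    moreover have "d * (2 * s / (1 + 2 * s)) = d - d / (1 + 2 * s)" using s by (simp add: field_simps)
    ultimately show ?thesis by (simp add: algebra_simps)
  qed
  finally have "sqrt ((1 - d) * exp (d * s / 2)) \<le> sqrt (1 - d / (1 + 2 * s))" by simp
  moreover have "sqrt (exp (d * s / 2)) = exp (d * s / 4)"
    by (rule real_sqrt_unique) (simp_all flip: exp_of_nat_mult)
  ultimately have le: "sqrt (1 - d) * exp (d * s / 4) \<le> sqrt (1 - d / (1 + 2 * s))" by (simp add: real_sqrt_mult)
  moreover have "0 < sqrt (1 - d) * exp (d * s / 4)" using d by simp
  ultimately have "0 < sqrt (1 - d / (1 + 2 * s))" by linarith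
  then show ?thesis using le by (simp add: exp_minus field_simps)
qed

text \<open>From ln(1 + u) >= u - u^2 at u = 2s; the lower-tail counterpart of
  \<open>inverse_sqrt_one_minus_le\<close>.\<close>

lemma inverse_sqrt_one_plus_le:
  fixes s :: real
  assumes "0 \<le> s" "s \<le> 1 / 4"
  shows "1 / sqrt (1 + 2 * s) \<le> exp (- s + 2 * s\<^sup>2)"
proof -
  have "2 * s - (2 * s)\<^sup>2 \<le> ln (1 + 2 * s)"
    using assms by (intro ln_one_plus_pos_lower_bound) auto
  then have "exp (2 * s - (2 * s)\<^sup>2) \<le> 1 + 2 * s"
    using assms by (simp add: ln_ge_iff)
  then have "exp (s - 2 * s\<^sup>2) \<le> sqrt (1 + 2 * s)"
    by (intro real_le_rsqrt) (simp add: power2_eq_square flip: exp_add)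
  then have "1 / sqrt (1 + 2 * s) \<le> 1 / exp (s - 2 * s\<^sup>2)"
    using assms by (intro divide_left_mono) (auto intro!: mult_pos_pos)
  also have "\<dots> = exp (- s + 2 * s\<^sup>2)" using exp_minus[of "s - 2 * s\<^sup>2"] by (simp add: inverse_eq_divide)
  finally show ?thesis .
qed

context uniform_prior
begin

text \<open>The Laplace transform of \<open>tot n p X\<close> given Q comes from
  \<open>nn_integral_std_normal_exp_proj\<close> with c = -2s. Per observation, the p coordinates
  give the null terms and each of the r columns an extra -ds/4.\<close>

lemma nn_integral_lik_exp_tot_le:
  assumes Q: "Q \<in> stiefel p r" and d: "0 \<le> d" "d \<le> 1 / 2" and s: "0 \<le> s" "s \<le> 1 / 4"
  shows "(\<integral>\<^sup>+X. ennreal (lik n p r d Q X) * ennreal (exp (- s * tot n p X)) \<partial>null_law n p)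
    \<le> ennreal (exp (real n * (real p * (- s + 2 * s\<^sup>2) - real r * (d * s / 4))))"
proof -
  have e1: "d / (1 + 2 * s) < 1" using d s by (simp add: field_simps)
  have "(\<integral>\<^sup>+X. ennreal (lik n p r d Q X) * ennreal (exp (- s * tot n p X)) \<partial>null_law n p)
     = (\<integral>\<^sup>+X. (\<Prod>i<n. ennreal (lik1 p r d Q (X i) * exp (- s * sqn p (X i)))) \<partial>null_law n p)"
    using d by (intro nn_integral_cong)
      (simp add: lik_def tot_def prod_ennreal lik1_nonneg ennreal_mult'[symmetric] prod_nonneg prod.distrib
        sum_distrib_left flip: exp_sum sum_negf)
  also have "\<dots> = (\<integral>\<^sup>+x. ennreal (lik1 p r d Q x * exp (- s * sqn p x)) \<partial>std_normal p) ^ n"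
    by (rule nn_integral_null_law_prod) measurable
  also have "(\<integral>\<^sup>+x. ennreal (lik1 p r d Q x * exp (- s * sqn p x)) \<partial>std_normal p)
     = ennreal (sqrt (1 - d) ^ r) * (\<integral>\<^sup>+x. ennreal (exp (- (2 * s) / 2 * sqn p x
         + (\<Sum>j<p. 0 * x j) + d / 2 * sqn r (tmul p Q x))) \<partial>std_normal p)"
    using d unfolding lik1_def
    by (subst nn_integral_cmult[symmetric]) (auto simp: ennreal_mult'[symmetric] exp_add[symmetric] sqn_def mult.assoc)
  also have "\<dots> = ennreal (sqrt (1 - d) ^ r) * ennreal ((1 / sqrt (1 + 2 * s)) ^ p * (1 / sqrt (1 - d / (1 + 2 * s))) ^ r)"
    using nn_integral_std_normal_exp_proj[OF Q, of "- (2 * s)" d "\<lambda>_. 0"] d s e1 by simp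
  also have "\<dots> = ennreal ((1 / sqrt (1 + 2 * s)) ^ p * (sqrt (1 - d) * (1 / sqrt (1 - d / (1 + 2 * s)))) ^ r)"
    using d by (simp add: ennreal_mult'[symmetric] power_mult_distrib mult_ac power_divide)
  also have "\<dots> ^ n \<le> ennreal (exp (real p * (- s + 2 * s\<^sup>2)) * exp (- real r * (d * s / 4))) ^ n"
  proof (intro power_mono ennreal_leI mult_mono)
    show "(1 / sqrt (1 + 2 * s)) ^ p \<le> exp (real p * (- s + 2 * s\<^sup>2))"
      unfolding exp_of_nat_mult using s by (intro power_mono inverse_sqrt_one_plus_le) auto
    have "(sqrt (1 - d) * (1 / sqrt (1 - d / (1 + 2 * s)))) ^ r \<le> exp (- (d * s / 4)) ^ r"
      using d s e1 by (intro power_mono lik1_ratio_le) auto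
    then show "(sqrt (1 - d) * (1 / sqrt (1 - d / (1 + 2 * s)))) ^ r \<le> exp (- real r * (d * s / 4))"
      by (simp flip: exp_of_nat_mult)
  qed (use d s e1 in auto)
  also have "\<dots> = ennreal (exp (real n * (real p * (- s + 2 * s\<^sup>2) - real r * (d * s / 4))))"
  proof -
    have "exp (real p * (- s + 2 * s\<^sup>2)) * exp (- real r * (d * s / 4))
        = exp (real p * (- s + 2 * s\<^sup>2) - real r * (d * s / 4))"
      by (simp flip: exp_add)
    then show ?thesis by (simp only: ennreal_power exp_ge_zero exp_of_nat_mult[of n])
  qed
  finally show ?thesis .
qed

lemma integrable_trace_test:
  assumes d: "0 \<le> d" "d < 1" and n: "n > 0"
  shows "integrable (alt_law n p d U) (trace_test q n p)"
proof -
  interpret A: prob_space "alt_law n p d U" by (rule prob_space_alt_law[OF d])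
  have s: "sets (alt_law n p d U) = sets (data_space n p)" by (simp add: alt_law_eq_density[OF d])
  have m: "trace_test q n p \<in> borel_measurable (alt_law n p d U)"
    using measurable_trace_test[OF n] by (simp only: measurable_cong_sets[OF s refl])
  have "norm (trace_test q n p X) \<le> 1" for X by (simp add: trace_test_def indicator_def)
  with m show ?thesis by (intro A.integrable_const_bound[of _ 1]) auto
qed

text \<open>Chernoff's bound for the lower tail, first for fixed Q and then averaged, since the
  bound is free of Q. At s = (2np)^{-1/2} the linear terms cancel, 2Ns^2 = 1 remains, and the spike
  contributes -nrds/4.\<close>

lemma test_power_trace_test_ge:
  assumes np: "8 \<le> n * p" and d: "0 \<le> d" "d \<le> 1 / 2"
  shows "1 - exp (1 + sqrt (2 * q * ln n) - real n * real r * d / (4 * sqrt (2 * real n * real p)))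
    \<le> test_power n p d U (trace_test q n p)"
proof -
  define a N s where "a = sqrt (2 * q * ln n)" and "N = real n * real p" and "s = 1 / sqrt (2 * N)"
  have n: "n > 0" using np by (cases n) auto
  have N: "N \<ge> 8" using np unfolding N_def by (metis of_nat_le_iff of_nat_mult of_nat_numeral)
  have "sqrt (2 * N) \<ge> 4" using N by (intro real_le_rsqrt) simp
  then have s4: "s \<le> 1 / 4" using N by (simp add: s_def field_simps)
  have s0: "s > 0" using N by (simp add: s_def)
  have s2: "N * (2 * s\<^sup>2) = 1" using N by (simp add: s_def power_divide)
  have d1: "d < 1" using d by simp
  define e where "e = exp (1 + a - real n * real r * d * s / 4)"
  let ?t = "trace_test q n p"
  interpret A: prob_space "alt_law n p d U" by (rule prob_space_alt_law[OF d(1) d1])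
  have [measurable]: "?t \<in> borel_measurable (data_space n p)" by (rule measurable_trace_test[OF n])
  have int: "integrable (alt_law n p d U) ?t" by (rule integrable_trace_test[OF d(1) d1 n])
  have "(\<integral>\<^sup>+X. ennreal (1 - ?t X) \<partial>alt_law n p d U)
      = (\<integral>\<^sup>+Q. \<integral>\<^sup>+X. ennreal (lik n p r d Q X) * ennreal (1 - ?t X) \<partial>null_law n p \<partial>U)"
    by (rule nn_integral_alt_law[OF d(1) d1]) measurable
  also have "\<dots> \<le> (\<integral>\<^sup>+Q. ennreal e \<partial>U)"
  proof (rule nn_integral_mono)
    fix Q assume "Q \<in> space U"
    then have Q: "Q \<in> stiefel p r" by (simp add: space_U)
    have [measurable]: "lik n p r d Q \<in> borel_measurable (data_space n p)" using Q by (rule measurable_lik_data)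
    have "(\<integral>\<^sup>+X. ennreal (lik n p r d Q X) * ennreal (1 - ?t X) \<partial>null_law n p)
       \<le> (\<integral>\<^sup>+X. ennreal (exp (a + s * N)) * (ennreal (lik n p r d Q X) * ennreal (exp (- s * tot n p X))) \<partial>null_law n p)"
    proof (rule nn_integral_mono)
      fix X
      have T: "1 / sqrt (2 * real n * real p) * (tot n p X - real n * real p) = s * tot n p X - s * N"
        unfolding s_def N_def by (simp only: right_diff_distrib mult.assoc)
      have "1 - ?t X \<le> exp (a + s * N + - s * tot n p X)"
        unfolding trace_test_eq[OF n] a_def[symmetric] T
      proof (cases "a \<le> s * tot n p X - s * N")
        case False
        then have "0 \<le> a + s * N + - s * tot n p X" by linarith
        then show "1 - (if a \<le> s * tot n p X - s * N then 1 else 0) \<le> exp (a + s * N + - s * tot n p X)"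
          using False by (simp only: if_False diff_zero one_le_exp_iff)
      qed (simp only: if_True diff_self exp_ge_zero)
      then have "ennreal (1 - ?t X) \<le> ennreal (exp (a + s * N)) * ennreal (exp (- s * tot n p X))"
        unfolding ennreal_exp_add[symmetric] by (rule ennreal_leI)
      then have "ennreal (lik n p r d Q X) * ennreal (1 - ?t X)
        \<le> ennreal (lik n p r d Q X) * (ennreal (exp (a + s * N)) * ennreal (exp (- s * tot n p X)))"
        by (rule mult_left_mono) simp
      then show "ennreal (lik n p r d Q X) * ennreal (1 - ?t X)
        \<le> ennreal (exp (a + s * N)) * (ennreal (lik n p r d Q X) * ennreal (exp (- s * tot n p X)))"
        by (simp only: mult.left_commute)
    qed
    also have "\<dots> = ennreal (exp (a + s * N)) *
        (\<integral>\<^sup>+X. ennreal (lik n p r d Q X) * ennreal (exp (- s * tot n p X)) \<partial>null_law n p)"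
      by (rule nn_integral_cmult) measurable
    also have "\<dots> \<le> ennreal (exp (a + s * N)) * ennreal (exp (real n * (real p * (- s + 2 * s\<^sup>2) - real r * (d * s / 4))))"
      using nn_integral_lik_exp_tot_le[OF Q d, of s n] s0 s4 by (intro mult_left_mono) auto
    also have "\<dots> = ennreal e"
    proof -
      have "real n * (real p * (- s + 2 * s\<^sup>2) - real r * (d * s / 4))
          = - s * N + N * (2 * s\<^sup>2) - real n * real r * d * s / 4"
        by (simp add: N_def algebra_simps)
      then show ?thesis unfolding e_def ennreal_exp_add[symmetric] s2 by simp
    qed
    finally show "(\<integral>\<^sup>+X. ennreal (lik n p r d Q X) * ennreal (1 - ?t X) \<partial>null_law n p) \<le> ennreal e" .
  qed
  also have "\<dots> = ennreal e" by (simp add: U.emeasure_space_1)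
  finally have le: "(\<integral>\<^sup>+X. ennreal (1 - ?t X) \<partial>alt_law n p d U) \<le> ennreal e" .
  have m: "(\<lambda>X. 1 - ?t X) \<in> borel_measurable (alt_law n p d U)"
    using int by (intro borel_measurable_diff borel_measurable_integrable) auto
  have t01: "0 \<le> 1 - ?t X" for X by (simp add: trace_test_def indicator_def)
  have "0 \<le> e" by (simp add: e_def)
  from integral_le_of_nn_integral_le[OF m t01 le this]
  have "(\<integral>X. 1 - ?t X \<partial>alt_law n p d U) \<le> e" .
  moreover have "(\<integral>X. 1 - ?t X \<partial>alt_law n p d U) = 1 - test_power n p d U ?t"
    using int by (simp add: test_power_def rejection_prob_def A.prob_space)
  moreover have "e = exp (1 + sqrt (2 * q * ln n) - real n * real r * d / (4 * sqrt (2 * real n * real p)))"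
    by (simp add: e_def a_def s_def N_def mult_ac)
  ultimately show ?thesis by simp
qed

end

section \<open>From the second moment to the smallest error sum\<close>

context uniform_prior
begin

text \<open>The test that never rejects has error sum 1, hence the upper bound. An infimum of reals
  needs boundedness below, which \<open>error_sum_ge\<close> supplies.\<close>

lemma INF_error_sum_bounds:
  assumes d: "0 \<le> d" "d < 1" and e: "e > 0"
    and sq: "(\<integral>\<^sup>+X. (mix_lik n d X)\<^sup>2 \<partial>null_law n p) \<le> ennreal (1 + e\<^sup>2)"
  shows "1 - e \<le> (INF \<phi>\<in>tests n p. error_sum n p d U \<phi>)"
    and "(INF \<phi>\<in>tests n p. error_sum n p d U \<phi>) \<le> 1"
proof -
  have ge: "1 - e \<le> error_sum n p d U \<phi>" if "\<phi> \<in> tests n p" for \<phi>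
    using error_sum_ge[OF d e sq that] .
  have 0: "(\<lambda>_. 0) \<in> tests n p" by (simp add: tests_def)
  show "1 - e \<le> (INF \<phi>\<in>tests n p. error_sum n p d U \<phi>)"
    using 0 ge by (intro cINF_greatest) auto
  have "bdd_below (error_sum n p d U ` tests n p)" using ge by (rule bdd_belowI2)
  then have "(INF \<phi>\<in>tests n p. error_sum n p d U \<phi>) \<le> error_sum n p d U (\<lambda>_. 0)"
    using 0 by (rule cINF_lower)
  then show "(INF \<phi>\<in>tests n p. error_sum n p d U \<phi>) \<le> 1"
    by (simp add: error_sum_def test_level_def test_power_def rejection_prob_def)
qed

text \<open>Since n <= p, the quantity y is at most 4kr, and k <= 2d^2; so (1 - y)^{-r/2} <= exp(ry)
  <= exp(8d^2r^2).\<close>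

lemma nn_integral_mix_lik_sq_le_exp:
  assumes d: "0 \<le> d" "d \<le> 1 / 16" and r: "1 \<le> r" and np: "n \<le> p" "0 < n"
    and small: "8 * d\<^sup>2 * (real r)\<^sup>2 \<le> 1 / 2"
  shows "(\<integral>\<^sup>+X. (mix_lik n d X)\<^sup>2 \<partial>null_law n p) \<le> ennreal (exp (8 * d\<^sup>2 * (real r)\<^sup>2) + exp (- real n / 2))"
proof -
  define k where "k = d\<^sup>2 / (1 - d)"
  define y where "y = 4 * k * real (r * n) / real p"
  have k0: "0 \<le> k" using d by (simp add: k_def)
  have "d\<^sup>2 * 1 \<le> d\<^sup>2 * (2 * (1 - d))" using d by (intro mult_left_mono) auto
  then have k2: "k \<le> 2 * d\<^sup>2" using d by (simp add: k_def field_simps)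
  have "d * d \<le> 1 / 16 * d" using d by (intro mult_right_mono) auto
  then have dk: "d + k \<le> 1 / 8" using k2 d unfolding power2_eq_square by linarith
  have kr: "4 * k * (real r)\<^sup>2 \<le> 8 * d\<^sup>2 * (real r)\<^sup>2" using k2 by (intro mult_right_mono) auto
  have "real r \<le> (real r)\<^sup>2" using r by (simp add: power2_eq_square)
  then have "4 * k * real r \<le> 4 * k * (real r)\<^sup>2" using k0 by (intro mult_left_mono) auto
  then have kr1: "4 * k * real r \<le> 1 / 2" using kr small by linarith
  have yr: "y \<le> 4 * k * real r"
  proof -
    have "4 * k * real r * real n \<le> 4 * k * real r * real p"
      using k0 np by (intro mult_left_mono) auto
    then show ?thesis using np by (simp add: y_def field_simps)
  qed
  have y: "0 \<le> y" "y \<le> 1 / 2" using yr kr1 k0 by (auto simp: y_def)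
  have "y < 1" using y by simp
  then have lt: "4 * k * real (r * n) < real p" using np by (simp add: y_def)
  have "(\<integral>\<^sup>+X. (mix_lik n d X)\<^sup>2 \<partial>null_law n p) \<le> ennreal ((1 / sqrt (1 - y)) ^ r + exp (- real (r * n) / 2))"
    using nn_integral_mix_lik_sq_le[of d n] d dk lt by (simp only: k_def y_def)
  also have "\<dots> \<le> ennreal (exp (8 * d\<^sup>2 * (real r)\<^sup>2) + exp (- real n / 2))"
  proof (intro ennreal_leI add_mono)
    \<comment> \<open>\<open>inverse_sqrt_one_minus_le\<close> at y/2 has exponent y/2 + y^2, which
      is at most y because y <= 1/2.\<close>
    have "y * y \<le> y * (1 / 2)" using y by (intro mult_left_mono) auto
    then have "1 / sqrt (1 - 2 * (y / 2)) \<le> exp y"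
      using inverse_sqrt_one_minus_le[of "y / 2"] y
      by (intro order_trans[OF inverse_sqrt_one_minus_le]) (auto simp: power2_eq_square)
    then have "(1 / sqrt (1 - y)) ^ r \<le> exp y ^ r" using y by (intro power_mono) auto
    also have "\<dots> = exp (real r * y)" by (simp add: exp_of_nat_mult)
    also have "real r * y \<le> real r * (4 * k * real r)" using yr by (intro mult_left_mono) auto
    then have "exp (real r * y) \<le> exp (8 * d\<^sup>2 * (real r)\<^sup>2)"
      using kr by (simp add: power2_eq_square mult_ac)
    finally show "(1 / sqrt (1 - y)) ^ r \<le> exp (8 * d\<^sup>2 * (real r)\<^sup>2)" .
    have "1 * real n \<le> real r * real n" using r by (intro mult_right_mono) auto
    then show "exp (- real (r * n) / 2) \<le> exp (- real n / 2)" by simp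
  qed
  finally show ?thesis .
qed

end

section \<open>Asymptotics\<close>

text \<open>Either rounding is at least 1 and within 1 of x, hence within a factor 2 of x >= 1; so
  both roundings are treated at once.\<close>

lemma rounded_bounds:
  fixes x :: real
  assumes "1 \<le> x" "m = nat \<lfloor>x\<rfloor> \<or> m = nat \<lceil>x\<rceil>"
  shows "1 \<le> m" "x / 2 \<le> real m" "real m \<le> 2 * x"
proof -
  have "1 \<le> \<lfloor>x\<rfloor>" "1 \<le> \<lceil>x\<rceil>" using assms(1) by linarith+
  then have "real m = of_int \<lfloor>x\<rfloor> \<or> real m = of_int \<lceil>x\<rceil>" "1 \<le> m"
    using assms(2) by (auto simp: Suc_le_eq)
  then show "1 \<le> m" "x / 2 \<le> real m" "real m \<le> 2 * x"
    using assms(1) floor_correct[of x] ceiling_correct[of x] by linarith+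
qed

theorem theorem1p1:
  fixes \<alpha> \<beta> \<gamma> q :: real
    and p r :: "nat \<Rightarrow> nat"
    and \<delta> :: "nat \<Rightarrow> real"
    and U :: "nat \<Rightarrow> real mat measure"
  assumes "0 < \<alpha>" "\<alpha> < 1" and "0 < \<beta>" "\<beta> < 1" and "1 \<le> \<gamma>" and "0 < q"
    and "\<And>n. n \<le> p n"
    and "(\<lambda>n. real (p n) / real n) \<longlonglongrightarrow> \<gamma>"
    and "\<And>n. r n = nat \<lfloor>real n powr (1 - \<beta>)\<rfloor> \<or> r n = nat \<lceil>real n powr (1 - \<beta>)\<rceil>"
    and "\<And>n. \<delta> n = real n powr (- \<alpha>)"
    and "\<And>n. uniform_stiefel (p n) (r n) (U n)"
  shows "(\<alpha> + \<beta> > 1 \<longrightarrow>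
            (\<lambda>n. INF \<phi>\<in>tests n (p n). error_sum n (p n) (\<delta> n) (U n) \<phi>) \<longlonglongrightarrow> 1) \<and>
         (\<alpha> + \<beta> < 1 \<longrightarrow>
            (\<lambda>n. test_level n (p n) (trace_test q n (p n))) \<longlonglongrightarrow> 0 \<and>
            (\<lambda>n. test_power n (p n) (\<delta> n) (U n) (trace_test q n (p n))) \<longlonglongrightarrow> 1)"
proof -
  interpret uniform_prior "p n" "r n" "U n" for n
    using assms(11) by unfold_locales
  note \<alpha> = assms(1,2) and \<beta> = assms(3,4) and q = assms(6) and np = assms(7)
  have \<delta>: "\<delta> n = real n powr (- \<alpha>)" for n by (rule assms(10))
  have \<delta>0: "0 \<le> \<delta> n" for n by (simp add: \<delta>)
  have r: "1 \<le> r n" "real n powr (1 - \<beta>) / 2 \<le> real (r n)" "real (r n) \<le> 2 * real n powr (1 - \<beta>)" if "n \<ge> 1" for n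
    using rounded_bounds[OF _ assms(9)[of n]] that \<beta> ge_one_powr_ge_zero[of "real n" "1 - \<beta>"] by auto
  have small: "eventually (\<lambda>n. \<delta> n \<le> 1 / 16) sequentially"
  proof -
    have "(\<lambda>n. real n powr (- \<alpha>)) \<longlonglongrightarrow> 0" using \<alpha> by real_asymp
    then have "eventually (\<lambda>n. real n powr (- \<alpha>) < 1 / 16) sequentially" by (rule order_tendstoD) simp
    then show ?thesis by eventually_elim (simp add: \<delta>)
  qed
  have "(\<lambda>n. INF \<phi>\<in>tests n (p n). error_sum n (p n) (\<delta> n) (U n) \<phi>) \<longlonglongrightarrow> 1" if ab: "\<alpha> + \<beta> > 1"
  proof (rule tendstoI)
    fix e :: real assume e: "e > 0"
    \<comment> \<open>The constant is 8 times the square of the rounding factor 2; the exponent is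
      negative exactly when \<alpha> + \<beta> > 1.\<close>
    define h where "h n = 32 * real n powr (2 - 2 * \<alpha> - 2 * \<beta>)" for n :: nat
    have h: "h \<longlonglongrightarrow> 0" unfolding h_def using ab by real_asymp
    have dr: "8 * (\<delta> n)\<^sup>2 * (real (r n))\<^sup>2 \<le> h n" if "n \<ge> 1" for n
    proof -
      have "(real (r n))\<^sup>2 \<le> (2 * real n powr (1 - \<beta>))\<^sup>2" using r(3)[OF that] by (intro power_mono) auto
      then have "8 * (\<delta> n)\<^sup>2 * (real (r n))\<^sup>2 \<le> 8 * (\<delta> n)\<^sup>2 * (2 * real n powr (1 - \<beta>))\<^sup>2"
        by (intro mult_left_mono) auto
      also have "\<dots> = 32 * (real n powr (- \<alpha>) * real n powr (- \<alpha>) * (real n powr (1 - \<beta>) * real n powr (1 - \<beta>)))"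
        by (simp add: \<delta> power2_eq_square)
      also have "\<dots> = h n" unfolding h_def powr_add[symmetric] by (simp add: algebra_simps)
      finally show ?thesis .
    qed
    have "(\<lambda>n. exp (h n) + exp (- real n / 2)) \<longlonglongrightarrow> exp 0 + 0"
      by (intro tendsto_add tendsto_exp h) real_asymp
    \<comment> \<open>Half of e is used so that the final distance is strictly below e.\<close>
    then have "eventually (\<lambda>n. exp (h n) + exp (- real n / 2) < 1 + (e / 2)\<^sup>2) sequentially"
      using e by (intro order_tendstoD) auto
    moreover have "eventually (\<lambda>n. h n < 1 / 2) sequentially" using h by (rule order_tendstoD) simp
    ultimately show "eventually (\<lambda>n. dist (INF \<phi>\<in>tests n (p n). error_sum n (p n) (\<delta> n) (U n) \<phi>) 1 < e) sequentially"
      using small eventually_ge_at_top[of 1]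
    proof eventually_elim
      case (elim n)
      have "(\<integral>\<^sup>+X. (mix_lik n n (\<delta> n) X)\<^sup>2 \<partial>null_law n (p n))
          \<le> ennreal (exp (8 * (\<delta> n)\<^sup>2 * (real (r n))\<^sup>2) + exp (- real n / 2))"
        using elim dr[of n] np r(1) \<delta>0 by (intro nn_integral_mix_lik_sq_le_exp) auto
      also have "\<dots> \<le> ennreal (1 + (e / 2)\<^sup>2)"
      proof (rule ennreal_leI)
        have "exp (8 * (\<delta> n)\<^sup>2 * (real (r n))\<^sup>2) \<le> exp (h n)" using dr[of n] elim by simp
        then show "exp (8 * (\<delta> n)\<^sup>2 * (real (r n))\<^sup>2) + exp (- real n / 2) \<le> 1 + (e / 2)\<^sup>2"
          using elim by linarith
      qed
      finally have "1 - e / 2 \<le> (INF \<phi>\<in>tests n (p n). error_sum n (p n) (\<delta> n) (U n) \<phi>)"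
        "(INF \<phi>\<in>tests n (p n). error_sum n (p n) (\<delta> n) (U n) \<phi>) \<le> 1"
        using INF_error_sum_bounds[of "\<delta> n" "e / 2" n n] e elim \<delta>0[of n] by auto
      then show ?case using e by (simp add: dist_real_def)
    qed
  qed
  moreover have "(\<lambda>n. test_level n (p n) (trace_test q n (p n))) \<longlonglongrightarrow> 0"
  proof (rule tendsto_sandwich)
    show "eventually (\<lambda>n. 0 \<le> test_level n (p n) (trace_test q n (p n))) sequentially"
      by (simp add: test_level_def rejection_prob_def trace_test_def)
    show "eventually (\<lambda>n. test_level n (p n) (trace_test q n (p n)) \<le> exp (2 - sqrt (2 * q * ln n))) sequentially"
      using eventually_ge_at_top[of 8]
    proof eventually_elim
      case (elim n)
      have "8 * 1 \<le> n * p n" using elim np[of n] by (intro mult_mono) auto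
      then show ?case by (intro test_level_trace_test_le) simp
    qed
    show "(\<lambda>n. exp (2 - sqrt (2 * q * ln (real n)))) \<longlonglongrightarrow> 0" using q by real_asymp
  qed simp
  moreover have "(\<lambda>n. test_power n (p n) (\<delta> n) (U n) (trace_test q n (p n))) \<longlonglongrightarrow> 1" if ab: "\<alpha> + \<beta> < 1"
  proof (rule tendsto_sandwich)
    \<comment> \<open>The 8 is 4 from the Chernoff exponent times 2 from rounding
      \<open>r n\<close>; the root comes from \<open>p n\<close> <= (\<gamma> + 1) n, valid
      eventually.\<close>
    define C where "C = 1 / (8 * sqrt (2 * (\<gamma> + 1)))"
    have C: "C > 0" using assms(5) by (simp add: C_def)
    \<comment> \<open>The power of n has a positive exponent and so outgrows the root of the
      logarithm.\<close>
    show "(\<lambda>n. 1 - exp (1 + sqrt (2 * q * ln (real n)) - C * real n powr (1 - \<alpha> - \<beta>))) \<longlonglongrightarrow> 1"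
      using q C ab by real_asymp
    have "eventually (\<lambda>n. real (p n) / real n < \<gamma> + 1) sequentially"
      using assms(8) by (rule order_tendstoD) simp
    then show "eventually (\<lambda>n. 1 - exp (1 + sqrt (2 * q * ln (real n)) - C * real n powr (1 - \<alpha> - \<beta>))
        \<le> test_power n (p n) (\<delta> n) (U n) (trace_test q n (p n))) sequentially"
      using small eventually_ge_at_top[of 8]
    proof eventually_elim
      case (elim n)
      have n: "real n > 0" using elim by simp
      have "8 * 1 \<le> n * p n" using elim np[of n] by (intro mult_mono) auto
      then have "1 - exp (1 + sqrt (2 * q * ln n) - real n * real (r n) * \<delta> n / (4 * sqrt (2 * real n * real (p n))))
          \<le> test_power n (p n) (\<delta> n) (U n) (trace_test q n (p n))"
        using elim \<delta>0 by (intro test_power_trace_test_ge) auto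
      moreover have "C * real n powr (1 - \<alpha> - \<beta>)
          \<le> real n * real (r n) * \<delta> n / (4 * sqrt (2 * real n * real (p n)))"
      proof -
        have "real (p n) \<le> (\<gamma> + 1) * real n" using elim n by (simp add: field_simps)
        then have "2 * real n * real (p n) \<le> 2 * real n * ((\<gamma> + 1) * real n)"
          using n by (intro mult_left_mono) auto
        also have "\<dots> = 2 * (\<gamma> + 1) * (real n)\<^sup>2" by (simp add: power2_eq_square)
        finally have "sqrt (2 * real n * real (p n)) \<le> sqrt (2 * (\<gamma> + 1) * (real n)\<^sup>2)" by simp
        also have "\<dots> = sqrt (2 * (\<gamma> + 1)) * real n" using n by (simp add: real_sqrt_mult)
        finally have s: "sqrt (2 * real n * real (p n)) \<le> sqrt (2 * (\<gamma> + 1)) * real n" .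
        have pn: "real (p n) > 0" using n np[of n] by simp
        have "real n powr (1 - \<alpha> - \<beta>) = real n powr (1 - \<beta>) * \<delta> n"
          unfolding \<delta> powr_add[symmetric] by (simp add: algebra_simps)
        then have "C * real n powr (1 - \<alpha> - \<beta>)
            = real n * (real n powr (1 - \<beta>) / 2) * \<delta> n / (4 * (sqrt (2 * (\<gamma> + 1)) * real n))"
          using n by (simp add: C_def)
        also have "\<dots> \<le> real n * real (r n) * \<delta> n / (4 * (sqrt (2 * (\<gamma> + 1)) * real n))"
          using r(2)[of n] elim \<delta>0[of n] assms(5) by (intro divide_right_mono mult_right_mono mult_left_mono) auto
        also have "\<dots> \<le> real n * real (r n) * \<delta> n / (4 * sqrt (2 * real n * real (p n)))"
          using s n pn \<delta>0[of n] assms(5) by (intro divide_left_mono mult_pos_pos) auto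
        finally show ?thesis .
      qed
      ultimately show ?case
        by (smt (verit) exp_le_cancel_iff)
    qed
    show "eventually (\<lambda>n. test_power n (p n) (\<delta> n) (U n) (trace_test q n (p n)) \<le> 1) sequentially"
      using small eventually_ge_at_top[of 1]
    proof eventually_elim
      case (elim n)
      interpret A: prob_space "alt_law n (p n) (\<delta> n) (U n)"
        using elim \<delta>0[of n] by (intro prob_space_alt_law) auto
      show ?case
        unfolding test_power_def rejection_prob_def
        using elim \<delta>0[of n]
        by (intro A.integral_le_const integrable_trace_test) (auto simp: trace_test_def indicator_def)
    qed
  qed simp
  ultimately show ?thesis by blast
qed

end
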